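(* Let $\Omega_0\subset\mathbb{R}^2$ be a non-empty open convex set that does not contain lines, let $\Omega_1\subset\mathbb{R}^2$ be an open convex set with $\mathrm{cl}\,\Omega_1\subset\Omega_0$, and let $\Omega=\mathrm{cl}(\Omega_0\setminus\Omega_1)$. Assume that neither $\partial\Omega_0$ nor $\partial\Omega_1$ contains linear segments, that $\partial\Omega_1$ is $C^2$-smooth, that $\Omega_0$ is unbounded and every ray contained in $\Omega_0$ can be translated so as to belong to $\Omega_1$ entirely, that $\partial\Omega_0$ is $C^2$-smooth, and that $f\in C^2(\partial\Omega_0)$. Then for every $x\in\Omega$ $$\mathfrak{B}_{\Omega,f}(x)=\inf\{\mathfrak{B}_{\tilde\Omega,f}(x):\ \tilde\Omega\text{ is an extension of }\Omega\}.$$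
   Context: A domain $\tilde\Omega$ is an extension of $\Omega$ if $\tilde\Omega=\mathrm{cl}\,\Omega_0\setminus\tilde\Omega_1$, where $\tilde\Omega_1$ is a convex open set with $\mathrm{cl}\,\tilde\Omega_1\subset\Omega_1$, $\partial\tilde\Omega_1$ contains no linear segments, and every ray contained in $\Omega_0$ can be translated so as to belong to $\tilde\Omega_1$ entirely. A function $G\colon\omega\to\mathbb{R}\cup\{+\infty\}$ is locally concave if its restriction to every segment contained in $\omega$ is concave. For $\omega=\Omega$ or $\omega=\tilde\Omega$, $\Lambda_{\omega,f}$ is the set of locally concave $G\colon\omega\to\mathbb{R}\cup\{+\infty\}$ with $G\ge f$ on $\partial\Omega_0$, and $\mathfrak{B}_{\omega,f}(x)=\inf_{G\in\Lambda_{\omega,f}}G(x)$, $x\in\omega$. *)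

theory Defs
  imports "HOL-Analysis.Analysis"
begin

definition contains_line :: "'a::real_vector set \<Rightarrow> bool" where
  "contains_line S \<longleftrightarrow> (\<exists>p v. v \<noteq> 0 \<and> range (\<lambda>t::real. p + t *\<^sub>R v) \<subseteq> S)"

definition is_ray :: "'a::real_vector set \<Rightarrow> bool" where
  "is_ray R \<longleftrightarrow> (\<exists>p v. v \<noteq> 0 \<and> R = (\<lambda>t::real. p + t *\<^sub>R v) ` {0..})"

definition contains_segment :: "'a::real_vector set \<Rightarrow> bool" where
  "contains_segment S \<longleftrightarrow> (\<exists>a b. a \<noteq> b \<and> closed_segment a b \<subseteq> S)"

definition rays_translatable :: "'a::real_vector set \<Rightarrow> 'a set \<Rightarrow> bool" where
  "rays_translatable A B \<longleftrightarrow> (\<forall>R. is_ray R \<and> R \<subseteq> A \<longrightarrow> (\<exists>w. (\<lambda>x. w + x) ` R \<subseteq> B))"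

definition C2_on :: "(real \<Rightarrow> 'a::real_normed_vector) \<Rightarrow> real set \<Rightarrow> bool" where
  "C2_on g I \<longleftrightarrow> g C1_differentiable_on I \<and>
     (\<lambda>t. vector_derivative g (at t)) C1_differentiable_on I"

text \<open>A local parametrization of \<open>S\<close> as an embedded curve: a regular \<open>C\<^sup>2\<close> map on an open
  interval which is a homeomorphism onto a relatively open subset of \<open>S\<close>.\<close>

definition C2_parametrization ::
  "'a::real_normed_vector set \<Rightarrow> real set \<Rightarrow> (real \<Rightarrow> 'a) \<Rightarrow> bool" where
  "C2_parametrization S I \<gamma> \<longleftrightarrow>
     open I \<and> is_interval I \<and> C2_on \<gamma> I \<and> (\<forall>t\<in>I. vector_derivative \<gamma> (at t) \<noteq> 0) \<and>
     openin (top_of_set S) (\<gamma> ` I) \<and> (\<exists>h. homeomorphism I (\<gamma> ` I) \<gamma> h)"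

definition C2_smooth_curve :: "'a::real_normed_vector set \<Rightarrow> bool" where
  "C2_smooth_curve S \<longleftrightarrow> (\<forall>p\<in>S. \<exists>I \<gamma>. C2_parametrization S I \<gamma> \<and> p \<in> \<gamma> ` I)"

text \<open>Only the values of \<open>f\<close> on \<open>S\<close> matter here; \<open>S\<close> is meant to be a \<open>C\<^sup>2\<close>-smooth curve.\<close>

definition C2_on_curve :: "'a::real_normed_vector set \<Rightarrow> ('a \<Rightarrow> real) \<Rightarrow> bool" where
  "C2_on_curve S f \<longleftrightarrow> (\<forall>I \<gamma>. C2_parametrization S I \<gamma> \<longrightarrow> C2_on (f \<circ> \<gamma>) I)"

text \<open>Functions \<open>\<omega> \<rightarrow> \<real> \<union> {+\<infinity>}\<close> are represented by total functions into \<^typ>\<open>ereal\<close>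
  that do not take the value \<open>-\<infinity>\<close> on \<open>\<omega>\<close>; their values outside \<open>\<omega>\<close> are irrelevant.
  In \<^typ>\<open>ereal\<close> we have \<open>0 * \<infinity> = 0\<close>, so the endpoint cases \<open>t = 0, 1\<close> below are trivial.\<close>

definition ereal_concave_on :: "'a::real_vector set \<Rightarrow> ('a \<Rightarrow> ereal) \<Rightarrow> bool" where
  "ereal_concave_on S G \<longleftrightarrow> convex S \<and>
     (\<forall>x\<in>S. \<forall>y\<in>S. \<forall>t\<in>{0..1::real}.
        ereal (1 - t) * G x + ereal t * G y \<le> G ((1 - t) *\<^sub>R x + t *\<^sub>R y))"

definition locally_concave_on :: "'a::real_vector set \<Rightarrow> ('a \<Rightarrow> ereal) \<Rightarrow> bool" where
  "locally_concave_on \<omega> G \<longleftrightarrow> (\<forall>x\<in>\<omega>. G x \<noteq> -\<infinity>) \<and>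
     (\<forall>a b. closed_segment a b \<subseteq> \<omega> \<longrightarrow> ereal_concave_on (closed_segment a b) G)"

definition Lambda_class ::
  "'a::real_normed_vector set \<Rightarrow> 'a set \<Rightarrow> ('a \<Rightarrow> real) \<Rightarrow> ('a \<Rightarrow> ereal) set" where
  "Lambda_class \<Omega>\<^sub>0 \<omega> f =
     {G. locally_concave_on \<omega> G \<and> (\<forall>x\<in>frontier \<Omega>\<^sub>0. ereal (f x) \<le> G x)}"

definition bellman ::
  "'a::real_normed_vector set \<Rightarrow> 'a set \<Rightarrow> ('a \<Rightarrow> real) \<Rightarrow> 'a \<Rightarrow> ereal" where
  "bellman \<Omega>\<^sub>0 \<omega> f x = (INF G \<in> Lambda_class \<Omega>\<^sub>0 \<omega> f. G x)"

definition is_extension ::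
  "'a::real_normed_vector set \<Rightarrow> 'a set \<Rightarrow> 'a set \<Rightarrow> bool" where
  "is_extension \<Omega>\<^sub>0 \<Omega>\<^sub>1 W \<longleftrightarrow>
     (\<exists>V. open V \<and> convex V \<and> closure V \<subseteq> \<Omega>\<^sub>1 \<and> \<not> contains_segment (frontier V) \<and>
          rays_translatable \<Omega>\<^sub>0 V \<and> W = closure \<Omega>\<^sub>0 - V)"

end

(* Given a locally concave G on the domain with G x finite, it suffices to extend G, up to an error
   epsilon, to a locally concave function on a slightly larger domain. Such a G is finite, and it
   is continuous up to the boundary of the hole: near a boundary point one can compare along
   lines that miss the hole. Adding a small bounded strongly concave function makes room for C^2-small
   perturbations; taking the minimum with locally shifted and perturbed copies of G, which are defined a
   little inside the hole, gives a locally concave function on a neighbourhood N of the boundary of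
   the hole. The hole is unbounded, so the width of N is not bounded below; but a sufficiently fast decaying
   convex shift along a direction of recession of the hole produces a convex smaller hole whose
   difference from the original one lies in N. *)

theory Submission
  imports Defs
begin

text \<open>Strict convexity makes every positive shift along a recession direction \<open>e\<close>
  of the hole carry the closed hole into the open one. Hence the translate of a function by a small
  multiple of \<open>e\<close> is defined at and slightly beyond the boundary of the hole; it stays
  concave on segments, and the error is controlled by a modulus of continuity alone, without any
  slope at the hole. No single shift serves the whole unbounded boundary, so translates must be
  glued. The glue is a multiple of a squared distance minus a constant: negative near its piece and
  positive away from it, it makes a minimum switch functions before one of them loses its domain,
  and its failure of concavity is at most quadratic. What pays for it is a bounded strongly concave
  function. On a line, a concave function bounded below is constant, which is where the absence of
  lines enters: functionals bounded below on the outer set then span the space, and a sum of terms 1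
  - exp(-functional) is strongly concave in every direction. Points of the outer boundary are
  treated apart. Finiteness of G there says nothing about finiteness inside, but both sides equal f
  there.\<close>

section \<open>Strictly convex sets and directions of recession\<close>

text \<open>If any point of the segment lay in \<open>S\<close>, so would all points strictly
  between it and \<open>p\<close> or \<open>q\<close>. Hence one relative interior point outside
  \<open>S\<close> forces the whole closed segment into the frontier.\<close>

lemma open_segment_subset_strictly_convex:
  fixes S :: "'a::euclidean_space set"
  assumes "open S" "convex S" "\<not> contains_segment (frontier S)"
    and p: "p \<in> closure S" and q: "q \<in> closure S"
  shows "open_segment p q \<subseteq> S"
proof (rule subsetI, rule ccontr)
  fix m assume m: "m \<in> open_segment p q" and mS: "m \<notin> S"
  have conv: "convex (closure S)" using assms by (simp add: convex_closure)
  have intS: "interior (closure S) = S"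
    using assms by (simp add: convex_interior_closure interior_open)
  have pq: "p \<noteq> q" using m by auto
  have "u \<notin> S" if u: "u \<in> closed_segment p q" for u
  proof
    assume uS: "u \<in> S"
    hence um: "u \<noteq> m" using mS by auto
    have "m \<in> open_segment u p \<or> m \<in> open_segment u q"
    proof -
      have "closed_segment p q = closed_segment p u \<union> closed_segment u q"
        using u Un_closed_segment by blast
      thus ?thesis using m um by (auto simp: open_segment_def closed_segment_commute)
    qed
    thus False
      using in_interior_closure_convex_segment[OF assms(2), of u p]
        in_interior_closure_convex_segment[OF assms(2), of u q] uS p q mS assms(1)
      by (auto simp: interior_open)
  qed
  moreover have "closed_segment p q \<subseteq> closure S"
    using closed_segment_subset[OF p q conv] .
  ultimately have "closed_segment p q \<subseteq> frontier S"
    using assms(1) by (auto simp: frontier_def interior_open)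
  thus False using assms(3) pq unfolding contains_segment_def by blast
qed

text \<open>The point \<open>p + t e\<close> is a limit of convex combinations of \<open>p\<close>
  with the ray points at parameter \<open>(n + 1) t\<close>, taken with weight
  \<open>1 / (n + 1)\<close>.\<close>

lemma recession_closed_convex:
  fixes C :: "'a::real_normed_vector set"
  assumes "closed C" "convex C" and ray: "\<And>t. 0 \<le> t \<Longrightarrow> p0 + t *\<^sub>R e \<in> C"
    and p: "p \<in> C" and t: "0 \<le> t"
  shows "p + t *\<^sub>R e \<in> C"
proof -
  let ?s = "\<lambda>n::nat. inverse (real (Suc n))"
  let ?x = "\<lambda>n. (1 - ?s n) *\<^sub>R p + ?s n *\<^sub>R (p0 + (real (Suc n) * t) *\<^sub>R e)"
  have "?x n \<in> C" for n
  proof (rule convexD_alt[OF assms(2) p])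
    show "p0 + (real (Suc n) * t) *\<^sub>R e \<in> C" using t by (intro ray) simp
    show "0 \<le> ?s n" "?s n \<le> 1" by (simp_all add: field_simps)
  qed
  moreover have "?x = (\<lambda>n. (1 - ?s n) *\<^sub>R p + ?s n *\<^sub>R p0 + t *\<^sub>R e)"
    by (auto simp: fun_eq_iff scaleR_add_right)
  moreover have "(\<lambda>n. (1 - ?s n) *\<^sub>R p + ?s n *\<^sub>R p0 + t *\<^sub>R e)
      \<longlonglongrightarrow> (1 - 0) *\<^sub>R p + 0 *\<^sub>R p0 + t *\<^sub>R e"
    by (intro tendsto_intros LIMSEQ_inverse_real_of_nat)
  ultimately show ?thesis
    using closed_sequentially[OF assms(1), of ?x] by auto
qed

text \<open>A ray in the closure suffices, because \<open>p + t e\<close> is the midpoint of the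
  interior point \<open>p\<close> and the point \<open>p + 2 t e\<close> of the closure.\<close>

lemma recession_open_convex:
  fixes S :: "'a::euclidean_space set"
  assumes "open S" "convex S" and ray: "\<And>t. 0 \<le> t \<Longrightarrow> p0 + t *\<^sub>R e \<in> closure S"
    and p: "p \<in> S" and t: "0 \<le> t"
  shows "p + t *\<^sub>R e \<in> S"
proof (cases "t = 0 \<or> e = 0")
  case False
  have q: "p + (2 * t) *\<^sub>R e \<in> closure S"
    by (rule recession_closed_convex[OF _ _ ray])
      (use assms closure_subset in \<open>auto simp: convex_closure\<close>)
  have "p + t *\<^sub>R e \<in> open_segment p (p + (2 * t) *\<^sub>R e)"
    unfolding in_segment using False t
    by (intro conjI exI[of _ "1/2"]) (auto simp: algebra_simps simp flip: scaleR_add_left)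
  thus ?thesis
    using in_interior_closure_convex_segment[OF assms(2) _ q, of p] p assms(1)
    by (auto simp: interior_open)
qed (use p in auto)

text \<open>Even a frontier point is pushed inside by a positive shift. This is what keeps
  translated functions defined at the boundary of the hole and the closure of a core inside the
  hole.\<close>

lemma recession_strictly_convex:
  fixes S :: "'a::euclidean_space set"
  assumes "open S" "convex S" "\<not> contains_segment (frontier S)"
    and ray: "\<And>t. 0 \<le> t \<Longrightarrow> p0 + t *\<^sub>R e \<in> closure S" and "e \<noteq> 0"
    and p: "p \<in> closure S" and t: "0 < t"
  shows "p + t *\<^sub>R e \<in> S"
proof -
  have q: "p + (2 * t) *\<^sub>R e \<in> closure S"
    by (rule recession_closed_convex[OF _ _ ray p])
      (use assms in \<open>auto simp: convex_closure\<close>)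
  have "p + t *\<^sub>R e \<in> open_segment p (p + (2 * t) *\<^sub>R e)"
    unfolding in_segment using assms(5) t
    by (intro conjI exI[of _ "1/2"]) (auto simp: algebra_simps simp flip: scaleR_add_left)
  thus ?thesis
    using open_segment_subset_strictly_convex[OF assms(1-3) p q] by auto
qed

text \<open>The directions from \<open>p\<close> to points of \<open>S\<close> escaping to infinity
  accumulate by compactness of the sphere, and convexity puts the limiting ray into the
  closure.\<close>

lemma unbounded_convex_contains_ray:
  fixes S :: "'a::euclidean_space set"
  assumes "open S" "convex S" "\<not> bounded S"
  obtains p v where "v \<noteq> 0" "\<And>t. 0 \<le> t \<Longrightarrow> p + t *\<^sub>R v \<in> S"
proof -
  obtain p where p: "p \<in> S" using assms(3) by fastforce
  have "\<exists>x\<in>S. norm (x - p) > real n" for n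
  proof (rule ccontr)
    assume "\<not> ?thesis"
    hence "S \<subseteq> cball p (real n)" by (auto simp: dist_norm norm_minus_commute not_less)
    thus False using assms(3) bounded_subset bounded_cball by blast
  qed
  then obtain x where x: "\<And>n. x n \<in> S" "\<And>n. norm (x n - p) > real n" by metis
  let ?d = "\<lambda>n. (x n - p) /\<^sub>R norm (x n - p)"
  have nz: "norm (x n - p) > 0" for n using x(2)[of n] by (meson of_nat_0_le_iff order_le_less_trans)
  have "\<forall>n. ?d n \<in> sphere 0 1" using nz by simp
  then obtain v r where v: "v \<in> sphere (0::'a) 1" "strict_mono r" "(?d \<circ> r) \<longlonglongrightarrow> v"
    using compact_imp_seq_compact[OF compact_sphere[of "0::'a" 1], THEN seq_compactE, of ?d]
    by metis
  have ray: "p + t *\<^sub>R v \<in> closure S" if t: "0 \<le> t" for t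
  proof -
    have "\<forall>\<^sub>F n in sequentially. p + t *\<^sub>R (?d \<circ> r) n \<in> closure S"
    proof (rule eventually_sequentiallyI[of "nat \<lceil>t\<rceil>"])
      fix n assume n: "nat \<lceil>t\<rceil> \<le> n"
      have "t \<le> real n" using n by linarith
      also have "real n \<le> real (r n)" using v(2) by (simp add: seq_suble)
      also have "\<dots> < norm (x (r n) - p)" by (rule x)
      finally have "t / norm (x (r n) - p) \<le> 1" using nz[of "r n"] by (simp add: field_simps)
      hence "(1 - t / norm (x (r n) - p)) *\<^sub>R p + (t / norm (x (r n) - p)) *\<^sub>R x (r n) \<in> S"
        using assms(2) p x(1) t by (intro convexD_alt) auto
      also have "(1 - t / norm (x (r n) - p)) *\<^sub>R p + (t / norm (x (r n) - p)) *\<^sub>R x (r n)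
          = p + t *\<^sub>R (?d \<circ> r) n"
        by (simp add: algebra_simps divide_inverse)
      finally show "p + t *\<^sub>R (?d \<circ> r) n \<in> closure S" using closure_subset by blast
    qed
    moreover have "(\<lambda>n. p + t *\<^sub>R (?d \<circ> r) n) \<longlonglongrightarrow> p + t *\<^sub>R v"
      by (intro tendsto_intros v(3))
    ultimately show ?thesis
      using Lim_in_closed_set[OF closed_closure _ trivial_limit_sequentially,
          of "\<lambda>n. p + t *\<^sub>R (?d \<circ> r) n"] by simp
  qed
  show thesis
  proof
    show "v \<noteq> 0" using v(1) by auto
    show "p + t *\<^sub>R v \<in> S" if "0 \<le> t" for t
      by (rule recession_open_convex[OF assms(1,2) ray p that])
  qed
qed

section \<open>Linear functionals bounded below on a convex set without lines\<close>

text \<open>A nonzero \<open>v\<close> orthogonal to all these functionals would be the direction of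
  a line in \<open>S\<close>: a functional separating \<open>p + t v\<close> from the closure is
  itself bounded below on \<open>S\<close>, yet takes the same value at \<open>p + t v\<close> as at
  \<open>p\<close>.\<close>

lemma barrier_cone_spans:
  fixes S :: "'a::euclidean_space set"
  assumes "open S" "convex S" "S \<noteq> {}" "\<not> contains_line S"
  shows "span {a. \<exists>b. \<forall>x\<in>S. b \<le> a \<bullet> x} = UNIV"
proof (rule ccontr)
  let ?B = "{a. \<exists>b. \<forall>x\<in>S. b \<le> a \<bullet> x}"
  assume "span ?B \<noteq> UNIV"
  hence "span ?B \<subset> span UNIV" by auto
  then obtain v where v: "v \<noteq> 0" "\<And>y. y \<in> span ?B \<Longrightarrow> orthogonal v y"
    using orthogonal_to_subspace_exists_gen by blast
  obtain p where p: "p \<in> S" using assms(3) by auto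
  have cl: "p + t *\<^sub>R v \<in> closure S" for t
  proof (rule ccontr)
    assume "p + t *\<^sub>R v \<notin> closure S"
    then obtain a b where ab: "a \<bullet> (p + t *\<^sub>R v) < b" "\<forall>x\<in>closure S. a \<bullet> x > b"
      using separating_hyperplane_closed_point[of "closure S" "p + t *\<^sub>R v"] assms(2)
      by (auto simp: convex_closure)
    hence "a \<in> ?B" using closure_subset[of S] by (auto intro!: exI[of _ b] less_imp_le)
    hence "orthogonal v a" by (intro v(2) span_base)
    hence "a \<bullet> (p + t *\<^sub>R v) = a \<bullet> p"
      by (simp add: inner_add_right orthogonal_def inner_commute)
    moreover have "a \<bullet> p > b" using ab(2) p closure_subset by blast
    ultimately show False using ab(1) by simp
  qed
  have "p + t *\<^sub>R v \<in> S" for t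
  proof (cases "0 \<le> t")
    case True
    thus ?thesis using recession_open_convex[OF assms(1,2) cl p] by simp
  next
    case False
    have "p + (- t) *\<^sub>R (- v) \<in> S"
      by (rule recession_open_convex[OF assms(1,2), of p "- v"])
        (use cl[of "- s" for s] p False in auto)
    thus ?thesis by simp
  qed
  thus False using assms(4) v(1) unfolding contains_line_def by blast
qed

lemma finite_spanning_barrier:
  fixes S :: "'a::euclidean_space set"
  assumes "open S" "convex S" "S \<noteq> {}" "\<not> contains_line S"
  obtains A :: "'a set" and b :: "'a \<Rightarrow> real"
  where "finite A" "span A = UNIV" "\<And>a x. a \<in> A \<Longrightarrow> x \<in> S \<Longrightarrow> b a \<le> a \<bullet> x"
proof -
  let ?B = "{a. \<exists>b. \<forall>x\<in>S. b \<le> a \<bullet> x}"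
  obtain A where A: "A \<subseteq> ?B" "independent A" "?B \<subseteq> span A"
    using maximal_independent_subset[of ?B] by auto
  have "span ?B \<subseteq> span A" using A(3) span_minimal subspace_span by blast
  hence "span A = UNIV" using barrier_cone_spans[OF assms] by auto
  moreover have "finite A" using A(2) independent_bound by blast
  moreover have "\<forall>a\<in>A. \<exists>b. \<forall>x\<in>S. b \<le> a \<bullet> x" using A(1) by auto
  then obtain b where "\<forall>a\<in>A. \<forall>x\<in>S. b a \<le> a \<bullet> x" by metis
  ultimately show thesis by (intro that[of A b]) auto
qed

text \<open>The quadratic form is positive definite because \<open>A\<close> spans; \<open>c\<close>
  is its minimum on the unit sphere.\<close>

lemma sum_squares_spanning_bound:
  fixes A :: "'a::euclidean_space set"
  assumes "finite A" "span A = UNIV"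
  obtains c where "c > 0" "\<And>x. c * (norm x)\<^sup>2 \<le> (\<Sum>a\<in>A. (a \<bullet> x)\<^sup>2)"
proof -
  let ?q = "\<lambda>x. \<Sum>a\<in>A. (a \<bullet> x)\<^sup>2"
  have pos: "?q x > 0" if "x \<noteq> 0" for x
  proof (rule ccontr)
    assume "\<not> ?q x > 0"
    hence "?q x = 0" using sum_nonneg[of A "\<lambda>a. (a \<bullet> x)\<^sup>2"] by force
    hence "\<forall>a\<in>A. a \<bullet> x = 0" using assms(1) by (simp add: sum_nonneg_eq_0_iff)
    hence "orthogonal x a" if "a \<in> A" for a using that by (simp add: orthogonal_def inner_commute)
    hence "orthogonal x x" using orthogonal_to_span[of x A x] assms(2) by (metis UNIV_I)
    thus False using that by (simp add: orthogonal_def)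
  qed
  obtain y where y: "y \<in> sphere (0::'a) 1" "\<And>x. x \<in> sphere 0 1 \<Longrightarrow> ?q y \<le> ?q x"
    using continuous_attains_inf[of "sphere (0::'a) 1" ?q] nonempty_Basis
    by (force intro!: continuous_intros)
  show thesis
  proof
    have "y \<noteq> 0" using y(1) by auto
    thus "?q y > 0" by (rule pos)
    show "?q y * (norm x)\<^sup>2 \<le> ?q x" for x
    proof (cases "x = 0")
      case False
      have "?q y \<le> ?q (x /\<^sub>R norm x)" using False by (intro y(2)) simp
      also have "\<dots> = ?q x / (norm x)\<^sup>2"
        by (simp add: sum_distrib_left power_mult_distrib divide_inverse power_inverse mult.commute)
      finally show ?thesis using False by (simp add: field_simps)
    qed simp
  qed
qed

section \<open>Concavity on segments is a local property\<close>

lemma concave_onI: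
  assumes "convex S"
    and "\<And>x y t. x \<in> S \<Longrightarrow> y \<in> S \<Longrightarrow> 0 \<le> t \<Longrightarrow> t \<le> 1 \<Longrightarrow>
      (1 - t) * f x + t * f y \<le> f ((1 - t) *\<^sub>R x + t *\<^sub>R y)"
  shows "concave_on S (f :: 'a::real_vector \<Rightarrow> real)"
  unfolding concave_on_def
proof (rule convex_onI[OF _ assms(1)])
  show "- f ((1 - t) *\<^sub>R x + t *\<^sub>R y) \<le> (1 - t) * - f x + t * - f y"
    if "0 < t" "t < 1" "x \<in> S" "y \<in> S" for t x y
    using assms(2)[of x y t] that by simp
qed

lemma concave_onD_alt:
  assumes "concave_on S (f :: 'a::real_vector \<Rightarrow> real)" "x \<in> S" "y \<in> S" "0 \<le> t" "t \<le> 1"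
  shows "(1 - t) * f x + t * f y \<le> f ((1 - t) *\<^sub>R x + t *\<^sub>R y)"
  using concave_onD[OF assms(1) assms(4,5,2,3)] by simp

lemma concave_on_real_chord:
  fixes u :: "real \<Rightarrow> real"
  assumes "concave_on S u" "x \<in> S" "z \<in> S" "x \<le> y" "y \<le> z"
  shows "(z - y) * u x + (y - x) * u z \<le> (z - x) * u y"
proof (cases "x = z")
  case False
  define t where "t = (y - x) / (z - x)"
  have t: "0 \<le> t" "t \<le> 1" "(z - x) * t = y - x"
    using assms False by (auto simp: t_def)
  hence "(1 - t) *\<^sub>R x + t *\<^sub>R z = y" by (simp add: algebra_simps)
  hence "(1 - t) * u x + t * u z \<le> u y"
    using concave_onD_alt[OF assms(1-3) t(1,2)] by simp
  hence "(z - x) * ((1 - t) * u x + t * u z) \<le> (z - x) * u y"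
    using assms(4,5) by (intro mult_left_mono) auto
  moreover have "(z - x) * ((1 - t) * u x + t * u z)
      = ((z - x) - (z - x) * t) * u x + ((z - x) * t) * u z"
    by (simp add: algebra_simps)
  ultimately show ?thesis by (simp add: t(3))
qed (use assms in auto)

lemma concave_on_real_chordI:
  fixes u :: "real \<Rightarrow> real"
  assumes "convex S"
    and "\<And>x y z. x \<in> S \<Longrightarrow> z \<in> S \<Longrightarrow> x < y \<Longrightarrow> y < z \<Longrightarrow>
      (z - y) * u x + (y - x) * u z \<le> (z - x) * u y"
  shows "concave_on S u"
  unfolding concave_on_def
proof (rule convex_on_linorderI[OF _ assms(1)])
  fix t x z :: real assume t: "0 < t" "t < 1" "x \<in> S" "z \<in> S" "x < z"
  define y where "y = (1 - t) *\<^sub>R x + t *\<^sub>R z"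
  have y: "y - x = t * (z - x)" "z - y = (1 - t) * (z - x)"
    by (simp_all add: y_def algebra_simps)
  have "0 < y - x" "0 < z - y" unfolding y using t by (auto intro: mult_pos_pos)
  hence "(z - y) * u x + (y - x) * u z \<le> (z - x) * u y"
    using t by (intro assms(2)) auto
  hence "(z - x) * ((1 - t) * u x + t * u z) \<le> (z - x) * u y"
    unfolding y by (simp add: algebra_simps)
  hence "(1 - t) * u x + t * u z \<le> u y" using t by simp
  thus "- u ((1 - t) *\<^sub>R x + t *\<^sub>R z) \<le> (1 - t) * - u x + t * - u z"
    by (simp add: y_def)
qed

text \<open>Subtracting the affine function through the values at \<open>b\<close> and
  \<open>c\<close> makes both vanish. The remainder \<open>w\<close> is then nonnegative between
  them and nonpositive outside, and the position of \<open>y\<close> decides which of the two zeros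
  to compare with.\<close>

lemma concave_on_overlap:
  fixes u :: "real \<Rightarrow> real"
  assumes ac: "concave_on {a..c} u" and bd: "concave_on {b..d} u"
    and "a \<le> b" "b < c" "c \<le> d"
  shows "concave_on {a..d} u"
proof (rule concave_on_real_chordI)
  fix x y z assume xyz: "x \<in> {a..d}" "z \<in> {a..d}" "x < y" "y < z"
  define s where "s = (u c - u b) / (c - b)"
  define w where "w p = u p - u b - s * (p - b)" for p
  have wb: "w b = 0" and wc: "w c = 0" using assms(4) by (auto simp: w_def s_def)
  have wch: "(q - p) * w o' + (p - o') * w q \<le> (q - o') * w p"
    if "o' \<in> T" "q \<in> T" "o' \<le> p" "p \<le> q" "concave_on T u" for o' p q T
    using concave_on_real_chord[OF that(5,1,2,3,4)] by (simp add: w_def algebra_simps)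
  have low: "w p \<le> 0" if "a \<le> p" "p \<le> b" for p
  proof -
    have "(c - b) * w p \<le> 0"
      using wch[of p "{a..c}" c b, OF _ _ _ _ ac] that assms by (auto simp: wb wc)
    thus ?thesis using assms(4) by (simp add: mult_le_0_iff)
  qed
  have high: "w p \<le> 0" if "c \<le> p" "p \<le> d" for p
  proof -
    have "(c - b) * w p \<le> 0"
      using wch[of b "{b..d}" p c, OF _ _ _ _ bd] that assms by (auto simp: wb wc)
    thus ?thesis using assms(4) by (simp add: mult_le_0_iff)
  qed
  have "(z - y) * w x + (y - x) * w z \<le> (z - x) * w y"
  proof (cases "z \<le> c \<or> b \<le> x")
    case True
    thus ?thesis
      using wch[of x "{a..c}" z y, OF _ _ _ _ ac] wch[of x "{b..d}" z y, OF _ _ _ _ bd] xyz by auto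
  next
    case False
    hence x: "w x \<le> 0" "x < b" and z: "w z \<le> 0" "c < z" using low[of x] high[of z] xyz by auto
    consider "y < b" | "b \<le> y" "y \<le> c" | "c < y" by linarith
    thus ?thesis
    proof cases
      case 1
      have "(b - y) * w x \<le> (b - x) * w y"
        using wch[of x "{a..c}" b y, OF _ _ _ _ ac] xyz x 1 assms by (auto simp: wb)
      hence "w y \<ge> (b - y) / (b - x) * w x" using x by (simp add: field_simps)
      hence "(z - x) * w y \<ge> (z - x) * ((b - y) / (b - x) * w x)"
        using xyz by (intro mult_left_mono) auto
      moreover have "(z - x) * ((b - y) / (b - x)) \<le> z - y"
      proof -
        have "(z - x) * (b - y) \<le> (z - y) * (b - x)"
          using mult_nonneg_nonneg[of "z - b" "y - x"] z xyz assms by (simp add: algebra_simps)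
        thus ?thesis using x by (simp add: field_simps)
      qed
      hence "(z - x) * ((b - y) / (b - x)) * w x \<ge> (z - y) * w x"
        using x by (intro mult_right_mono_neg)
      moreover have "(y - x) * w z \<le> 0" using xyz z by (simp add: mult_le_0_iff)
      ultimately show ?thesis by (simp add: mult.assoc)
    next
      case 2
      have "0 \<le> (c - b) * w y"
        using wch[of b "{b..d}" c y, OF _ _ _ _ bd] 2 assms by (auto simp: wb wc)
      hence "0 \<le> w y" using assms(4) by (simp add: zero_le_mult_iff)
      hence "0 \<le> (z - x) * w y" using xyz by simp
      moreover have "(y - x) * w z \<le> 0" "(z - y) * w x \<le> 0"
        using xyz z x by (simp_all add: mult_le_0_iff)
      ultimately show ?thesis by linarith
    next
      case 3
      have "(y - c) * w z \<le> (z - c) * w y"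
        using wch[of c "{b..d}" z y, OF _ _ _ _ bd] xyz z 3 assms by (auto simp: wc)
      hence "w y \<ge> (y - c) / (z - c) * w z" using z by (simp add: field_simps)
      hence "(z - x) * w y \<ge> (z - x) * ((y - c) / (z - c) * w z)"
        using xyz by (intro mult_left_mono) auto
      moreover have "(z - x) * ((y - c) / (z - c)) \<le> y - x"
      proof -
        have "(z - x) * (y - c) \<le> (y - x) * (z - c)"
          using mult_nonneg_nonneg[of "c - x" "z - y"] x xyz assms by (simp add: algebra_simps)
        thus ?thesis using z by (simp add: field_simps)
      qed
      hence "(z - x) * ((y - c) / (z - c)) * w z \<ge> (y - x) * w z"
        using z by (intro mult_right_mono_neg)
      moreover have "(z - y) * w x \<le> 0" using xyz x by (simp add: mult_le_0_iff)
      ultimately show ?thesis by (simp add: mult.assoc)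
    qed
  qed
  thus "(z - y) * u x + (y - x) * u z \<le> (z - x) * u y" by (simp add: w_def algebra_simps)
qed simp

lemma concave_on_real_local:
  fixes u :: "real \<Rightarrow> real"
  assumes "a \<le> b"
    and loc: "\<And>t. t \<in> {a..b} \<Longrightarrow> \<exists>d>0. concave_on ({a..b} \<inter> ball t d) u"
  shows "concave_on {a..b} u"
proof -
  have sub: "concave_on T u" if "concave_on T' u" "T \<subseteq> T'" "convex T" for T T'
    using that unfolding concave_on_def by (blast intro: convex_on_subset)
  \<comment> \<open>Concavity is demanded on a slight enlargement of \<open>{p..q}\<close>, so that
    adjacent intervals overlap in positive length and \<open>concave_on_overlap\<close> applies in
    the bisection.\<close>
  define P where "P p q \<longleftrightarrow> a \<le> p \<and> q \<le> b \<longrightarrow>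
    (\<exists>d>0. concave_on {max a (p - d)..min b (q + d)} u)" for p q
  have "P a b"
  proof (rule Bolzano[of a b P, OF assms(1)])
    fix p q r assume trans: "P p q" "P q r" "p \<le> q" "q \<le> r"
    show "P p r"
      unfolding P_def
    proof safe
      assume pr: "a \<le> p" "r \<le> b"
      obtain d1 where d1: "d1 > 0" "concave_on {max a (p - d1)..min b (q + d1)} u"
        using trans pr unfolding P_def by auto
      obtain d2 where d2: "d2 > 0" "concave_on {max a (q - d2)..min b (r + d2)} u"
        using trans pr unfolding P_def by auto
      define d where "d = min d1 d2"
      have 1: "concave_on {max a (p - d)..min b (q + d)} u"
        by (rule sub[OF d1(2)]) (auto simp: d_def)
      have 2: "concave_on {max a (q - d)..min b (r + d)} u"
        by (rule sub[OF d2(2)]) (auto simp: d_def)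
      have d: "d > 0" using d1 d2 by (simp add: d_def)
      have "concave_on {max a (p - d)..min b (r + d)} u"
      proof (cases "max a (q - d) < min b (q + d)")
        case True
        show ?thesis
          by (rule concave_on_overlap[OF 1 2]) (use True trans d in auto)
      next
        case False
        hence "a = b" using pr trans d by linarith
        thus ?thesis using trans pr d by (intro sub[OF 1]) auto
      qed
      thus "\<exists>d>0. concave_on {max a (p - d)..min b (r + d)} u" using d by blast
    qed
  next
    fix t assume "a \<le> t" "t \<le> b"
    then obtain d where d: "d > 0" "concave_on ({a..b} \<inter> ball t d) u" using loc[of t] by auto
    show "\<exists>d>0. \<forall>p q. p \<le> t \<and> t \<le> q \<and> q - p < d \<longrightarrow> P p q"
    proof (intro exI[of _ "d/2"] conjI allI impI)
      fix p q assume pq: "p \<le> t \<and> t \<le> q \<and> q - p < d / 2"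
      have "concave_on {max a (p - d/2)..min b (q + d/2)} u"
      proof -
        have "{max a (p - d/2)..min b (q + d/2)} \<subseteq> {a..b} \<inter> ball t d"
          using pq d(1) by (auto simp: dist_real_def)
        thus ?thesis by (rule sub[OF d(2)]) simp
      qed
      thus "P p q" unfolding P_def using d(1) by (intro impI exI[of _ "d/2"]) simp
    qed (use d in simp)
  qed
  then obtain d where "d > 0" "concave_on {max a (a - d)..min b (b + d)} u"
    unfolding P_def by auto
  thus ?thesis by (simp add: max_def min_def)
qed

section \<open>Real functions concave on every segment of a set\<close>

text \<open>This is the finite-valued counterpart of \<open>locally_concave_on\<close>; it makes
  real arithmetic and continuity arguments available once infinite values are excluded.\<close>

definition segment_concave_on :: "'a::real_vector set \<Rightarrow> ('a \<Rightarrow> real) \<Rightarrow> bool" where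
  "segment_concave_on S g \<longleftrightarrow>
     (\<forall>a b. closed_segment a b \<subseteq> S \<longrightarrow> concave_on (closed_segment a b) g)"

lemma segment_concave_on_subset:
  "segment_concave_on T g \<Longrightarrow> S \<subseteq> T \<Longrightarrow> segment_concave_on S g"
  unfolding segment_concave_on_def by blast

lemma segment_concave_on_iff_concave_on:
  assumes "convex S"
  shows "segment_concave_on S g \<longleftrightarrow> concave_on S g"
proof
  assume g: "segment_concave_on S g"
  show "concave_on S g"
  proof (rule concave_onI[OF assms])
    fix x y and t :: real assume "x \<in> S" "y \<in> S" "0 \<le> t" "t \<le> 1"
    moreover from this have "concave_on (closed_segment x y) g"
      using g assms closed_segment_subset unfolding segment_concave_on_def by blast
    ultimately show "(1 - t) * g x + t * g y \<le> g ((1 - t) *\<^sub>R x + t *\<^sub>R y)"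
      by (intro concave_onD_alt[of "closed_segment x y"]) auto
  qed
next
  assume "concave_on S g"
  thus "segment_concave_on S g"
    unfolding segment_concave_on_def concave_on_def
    using convex_on_subset convex_closed_segment by blast
qed

lemma segment_concave_onD:
  assumes "segment_concave_on S g" "closed_segment x y \<subseteq> S" "0 \<le> t" "t \<le> 1"
  shows "(1 - t) * g x + t * g y \<le> g ((1 - t) *\<^sub>R x + t *\<^sub>R y)"
  using assms concave_onD_alt[of "closed_segment x y" g x y t]
  unfolding segment_concave_on_def by auto

lemma segment_concave_on_cong:
  assumes "segment_concave_on S g" "\<And>x. x \<in> S \<Longrightarrow> g x = h x"
  shows "segment_concave_on S h"
  unfolding segment_concave_on_def
proof (intro allI impI)
  fix a b assume ab: "closed_segment a b \<subseteq> S"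
  show "concave_on (closed_segment a b) h"
  proof (rule concave_onI)
    fix x y and t :: real
    assume *: "x \<in> closed_segment a b" "y \<in> closed_segment a b" "0 \<le> t" "t \<le> 1"
    have "closed_segment x y \<subseteq> S" using * ab subset_closed_segment by blast
    moreover have "(1 - t) *\<^sub>R x + t *\<^sub>R y \<in> closed_segment x y" using * by (auto simp: in_segment)
    ultimately show "(1 - t) * h x + t * h y \<le> h ((1 - t) *\<^sub>R x + t *\<^sub>R y)"
      using segment_concave_onD[OF assms(1) _ *(3,4)] assms(2) by (metis ends_in_segment subsetD)
  qed simp
qed

text \<open>The glued function is a minimum whose index set can be fixed only near each point, so
  its concavity has to be checked locally. Each segment reduces the claim to an interval.\<close>

lemma segment_concave_on_local:
  fixes g :: "'a::real_normed_vector \<Rightarrow> real"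
  assumes loc: "\<And>p. p \<in> S \<Longrightarrow> \<exists>d>0. segment_concave_on (S \<inter> ball p d) g"
  shows "segment_concave_on S g"
  unfolding segment_concave_on_def
proof (intro allI impI)
  fix a b assume ab: "closed_segment a b \<subseteq> S"
  define l where "l t = (1 - t) *\<^sub>R a + t *\<^sub>R b" for t :: real
  have lS: "l t \<in> S" if "t \<in> {0..1}" for t
  proof -
    have "l t \<in> closed_segment a b" using that by (auto simp: l_def in_segment)
    thus ?thesis using ab by blast
  qed
  have ldiff: "l s - l t = (s - t) *\<^sub>R (b - a)" for s t by (simp add: l_def algebra_simps)
  have lcomb: "l ((1 - s) * t + s * t') = (1 - s) *\<^sub>R l t + s *\<^sub>R l t'" for s t t'
    by (simp add: l_def algebra_simps)
  have conc: "concave_on {0..1} (\<lambda>t. g (l t))"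
  proof (rule concave_on_real_local)
    fix t :: real assume t: "t \<in> {0..1}"
    obtain d where d: "d > 0" "segment_concave_on (S \<inter> ball (l t) d) g"
      using loc[OF lS[OF t]] by auto
    define e where "e = d / (norm (b - a) + 1)"
    have e: "e > 0" using d by (simp add: e_def add_nonneg_pos)
    have near: "l s \<in> S \<inter> ball (l t) d" if s: "s \<in> {0..1} \<inter> ball t e" for s
    proof -
      have "dist (l t) (l s) = \<bar>t - s\<bar> * norm (b - a)" by (simp add: dist_norm ldiff)
      also have "\<dots> \<le> \<bar>t - s\<bar> * (norm (b - a) + 1)" by (intro mult_left_mono) auto
      also have "\<dots> < e * (norm (b - a) + 1)"
        using s by (intro mult_strict_right_mono) (auto simp: dist_real_def add_nonneg_pos)
      also have "\<dots> = d" unfolding e_def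
        using norm_ge_zero[of "b - a"] by (simp del: norm_ge_zero add: add_nonneg_eq_0_iff)
      finally show ?thesis using s lS by auto
    qed
    have "concave_on ({0..1} \<inter> ball t e) (\<lambda>t. g (l t))"
    proof (rule concave_onI)
      show cv: "convex ({0..1} \<inter> ball t e)" by (intro convex_Int) auto
      fix x y s :: real
      assume *: "x \<in> {0..1} \<inter> ball t e" "y \<in> {0..1} \<inter> ball t e" "0 \<le> s" "s \<le> 1"
      have "closed_segment (l x) (l y) \<subseteq> S \<inter> ball (l t) d"
      proof
        fix p assume "p \<in> closed_segment (l x) (l y)"
        then obtain r where r: "0 \<le> r" "r \<le> 1" "p = l ((1 - r) * x + r * y)"
          by (auto simp: in_segment lcomb)
        have "(1 - r) *\<^sub>R x + r *\<^sub>R y \<in> {0..1} \<inter> ball t e"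
          using convexD_alt[OF cv *(1,2) r(1,2)] by simp
        thus "p \<in> S \<inter> ball (l t) d" using near r(3) by simp
      qed
      from segment_concave_onD[OF d(2) this *(3,4)]
      show "(1 - s) * g (l x) + s * g (l y) \<le> g (l ((1 - s) *\<^sub>R x + s *\<^sub>R y))"
        by (simp add: lcomb)
    qed
    thus "\<exists>d>0. concave_on ({0..1} \<inter> ball t d) (\<lambda>t. g (l t))" using e by blast
  qed simp
  show "concave_on (closed_segment a b) g"
  proof (rule concave_onI)
    fix x y and t :: real
    assume *: "x \<in> closed_segment a b" "y \<in> closed_segment a b" "0 \<le> t" "t \<le> 1"
    obtain r s where rs: "r \<in> {0..1}" "x = l r" "s \<in> {0..1}" "y = l s"
      using * by (auto simp: in_segment l_def)
    show "(1 - t) * g x + t * g y \<le> g ((1 - t) *\<^sub>R x + t *\<^sub>R y)"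
      using concave_onD_alt[OF conc rs(1,3) *(3,4)] rs by (simp add: lcomb)
  qed simp
qed

lemma segment_concave_on_Min:
  fixes c :: "'i \<Rightarrow> 'a::real_vector \<Rightarrow> real"
  assumes "finite J" "J \<noteq> {}" "\<And>j. j \<in> J \<Longrightarrow> segment_concave_on S (c j)"
  shows "segment_concave_on S (\<lambda>p. Min ((\<lambda>j. c j p) ` J))"
  unfolding segment_concave_on_def
proof (intro allI impI concave_onI)
  fix a b x y and t :: real
  assume ab: "closed_segment a b \<subseteq> S"
    and *: "x \<in> closed_segment a b" "y \<in> closed_segment a b" "0 \<le> t" "t \<le> 1"
  let ?M = "\<lambda>p. Min ((\<lambda>j. c j p) ` J)"
  have "(1 - t) * ?M x + t * ?M y \<le> c j ((1 - t) *\<^sub>R x + t *\<^sub>R y)" if j: "j \<in> J" for j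
  proof -
    have "(1 - t) * ?M x + t * ?M y \<le> (1 - t) * c j x + t * c j y"
      using j assms(1) * by (intro add_mono mult_left_mono) auto
    also have "\<dots> \<le> c j ((1 - t) *\<^sub>R x + t *\<^sub>R y)"
      using assms(3)[OF j] ab * unfolding segment_concave_on_def
      by (intro concave_onD_alt[of "closed_segment a b"]) auto
    finally show ?thesis .
  qed
  thus "(1 - t) * ?M x + t * ?M y \<le> ?M ((1 - t) *\<^sub>R x + t *\<^sub>R y)"
    using assms(1,2) by (subst Min_ge_iff) auto
qed simp

section \<open>Convex cores close to the boundary\<close>

text \<open>\<open>\<kappa>\<close> is a supremum of hinges \<open>c k * max 0 (k - t)\<close>. At
  \<open>t \<ge> j\<close> only hinges with \<open>k > t\<close> are active; they are at most
  \<open>c k * k\<close>, which the choice of \<open>c k\<close> keeps at most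
  \<open>\<delta> j\<close>.\<close>

lemma small_decreasing_convex_function:
  fixes \<delta> :: "nat \<Rightarrow> real"
  assumes "\<And>k. 0 < \<delta> k"
  obtains \<kappa> :: "real \<Rightarrow> real"
  where "\<And>t. 0 < \<kappa> t" "convex_on UNIV \<kappa>" "antimono \<kappa>" "\<And>k t. real k \<le> t \<Longrightarrow> \<kappa> t \<le> \<delta> k"
proof -
  \<comment> \<open>The minimum with 1 and the factor \<open>1 / (2 (k + 1))\<close> bound both
    \<open>c k\<close> and \<open>c k * k\<close> by 1, so that the supremum is finite for negative
    \<open>t\<close> as well.\<close>
  define c where "c k = min 1 (Min (\<delta> ` {..k})) / (2 * (real k + 1))" for k
  define \<phi> where "\<phi> k t = c k * max 0 (real k - t)" for k t
  define \<kappa> where "\<kappa> t = (SUP k. \<phi> k t)" for t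
  have cpos: "0 < c k" for k using assms by (simp add: c_def)
  have c1: "c k * real k \<le> 1" for k
  proof -
    have "min 1 (Min (\<delta> ` {..k})) * real k \<le> 1 * (2 * (real k + 1))"
      by (rule mult_mono) auto
    thus ?thesis by (simp add: c_def divide_simps)
  qed
  have c2: "c k \<le> 1" for k
  proof -
    have "min 1 (Min (\<delta> ` {..k})) \<le> 1" by (rule min.cobounded1)
    also have "\<dots> \<le> 2 * (real k + 1)" by simp
    finally show ?thesis by (simp add: c_def divide_simps)
  qed
  have c3: "c k * real k \<le> \<delta> j" if "j \<le> k" for j k
  proof -
    have "Min (\<delta> ` {..k}) \<le> \<delta> j" using that by (intro Min_le) auto
    hence "min 1 (Min (\<delta> ` {..k})) * real k \<le> \<delta> j * (2 * (real k + 1))"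
      using assms[of j] by (intro mult_mono) auto
    thus ?thesis by (simp add: c_def divide_simps)
  qed
  have bd: "\<phi> k t \<le> 1 + \<bar>t\<bar>" for k t
  proof -
    have "\<phi> k t \<le> c k * (real k + \<bar>t\<bar>)"
      unfolding \<phi>_def using cpos[of k] by (intro mult_left_mono) auto
    also have "\<dots> \<le> 1 + 1 * \<bar>t\<bar>"
      unfolding distrib_left by (intro add_mono c1 mult_right_mono c2) auto
    finally show ?thesis by simp
  qed
  have bdd: "bdd_above (range (\<lambda>k. \<phi> k t))" for t
    using bd by (auto intro!: bdd_aboveI[where M = "1 + \<bar>t\<bar>"])
  have up: "\<phi> k t \<le> \<kappa> t" for k t unfolding \<kappa>_def using bdd by (rule cSUP_upper[OF UNIV_I])
  have least: "\<kappa> t \<le> M" if "\<And>k. \<phi> k t \<le> M" for t M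
    unfolding \<kappa>_def by (rule cSUP_least) (use that in auto)
  show thesis
  proof
    show "0 < \<kappa> t" for t
    proof -
      obtain k :: nat where "t < real k" using reals_Archimedean2 by blast
      hence "0 < \<phi> k t" using cpos[of k] by (simp add: \<phi>_def)
      thus ?thesis using up[of k t] by linarith
    qed
    show "antimono \<kappa>"
    proof (rule antimonoI, rule least)
      fix s t :: real and k assume "s \<le> t"
      hence "\<phi> k t \<le> \<phi> k s" unfolding \<phi>_def using cpos[of k] by (intro mult_left_mono) auto
      thus "\<phi> k t \<le> \<kappa> s" using up[of k s] by linarith
    qed
    show "convex_on UNIV \<kappa>"
    proof (rule convex_onI)
      fix t x y :: real assume t: "0 < t" "t < 1"
      show "\<kappa> ((1 - t) *\<^sub>R x + t *\<^sub>R y) \<le> (1 - t) * \<kappa> x + t * \<kappa> y"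
      proof (rule least)
        fix k
        have "max 0 (real k - ((1 - t) * x + t * y))
            \<le> (1 - t) * max 0 (real k - x) + t * max 0 (real k - y)"
        proof (rule max.boundedI)
          have "(1 - t) * (real k - x) + t * (real k - y)
              \<le> (1 - t) * max 0 (real k - x) + t * max 0 (real k - y)"
            using t by (intro add_mono mult_left_mono) auto
          thus "real k - ((1 - t) * x + t * y)
              \<le> (1 - t) * max 0 (real k - x) + t * max 0 (real k - y)"
            by (simp add: algebra_simps)
          show "0 \<le> (1 - t) * max 0 (real k - x) + t * max 0 (real k - y)"
            using t by (intro add_nonneg_nonneg mult_nonneg_nonneg) simp_all
        qed
        hence "\<phi> k ((1 - t) *\<^sub>R x + t *\<^sub>R y) \<le> c k * ((1 - t) * max 0 (real k - x) + t * max 0 (real k - y))"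
          unfolding \<phi>_def using cpos[of k] by (intro mult_left_mono) auto
        also have "\<dots> = (1 - t) * \<phi> k x + t * \<phi> k y" by (simp add: \<phi>_def algebra_simps)
        also have "\<dots> \<le> (1 - t) * \<kappa> x + t * \<kappa> y"
          using t up by (intro add_mono mult_left_mono) auto
        finally show "\<phi> k ((1 - t) *\<^sub>R x + t *\<^sub>R y) \<le> (1 - t) * \<kappa> x + t * \<kappa> y" .
      qed
    qed simp
    show "\<kappa> t \<le> \<delta> j" if "real j \<le> t" for j t
    proof (rule least)
      fix k
      show "\<phi> k t \<le> \<delta> j"
      proof (cases "real k \<le> t")
        case True
        thus ?thesis using assms[of j] by (simp add: \<phi>_def)
      next
        case False
        have "\<phi> k t \<le> c k * real k"
          unfolding \<phi>_def using cpos[of k] False that by (intro mult_left_mono) auto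
        also have "\<dots> \<le> \<delta> j" using False that by (intro c3) auto
        finally show ?thesis .
      qed
    qed
  qed
qed

text \<open>The core is the preimage of \<open>S\<close> under \<open>p \<mapsto> p - \<kappa> (l \<bullet> p) e\<close>; it is convex because \<open>\<kappa>\<close> is
  convex and \<open>e\<close> is a direction of recession.\<close>

lemma strictly_convex_core:
  fixes S N :: "'a::euclidean_space set"
  assumes S: "open S" "convex S" "\<not> contains_segment (frontier S)"
    and ray: "\<And>t. 0 \<le> t \<Longrightarrow> p0 + t *\<^sub>R e \<in> S"
    and le: "l \<bullet> e = 1" and lb: "\<And>x. x \<in> S \<Longrightarrow> \<beta> \<le> l \<bullet> x"
    and bd: "\<And>k. bounded (S \<inter> {x. l \<bullet> x \<le> k})"
    and N: "open N" "frontier S \<subseteq> N"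
  obtains V where "open V" "convex V" "closure V \<subseteq> S" "\<not> contains_segment (frontier V)"
    "\<exists>w. (+) w ` S \<subseteq> V" "S - V \<subseteq> N"
proof -
  have e0: "e \<noteq> 0" using le by auto
  have rayc: "p0 + t *\<^sub>R e \<in> closure S" if "0 \<le> t" for t using ray[OF that] closure_subset by blast
  have lbc: "\<beta> \<le> l \<bullet> x" if "x \<in> closure S" for x
  proof -
    have "closure S \<subseteq> {x. \<beta> \<le> l \<bullet> x}"
      by (rule closure_minimal) (use lb in \<open>auto simp: closed_halfspace_ge\<close>)
    thus ?thesis using that by auto
  qed
  \<comment> \<open>Over a bounded slice of the frontier \<open>N\<close> has a positive width along
    \<open>e\<close>; it may shrink from slice to slice.\<close>
  have "\<forall>k. \<exists>\<epsilon>>0. \<forall>z\<in>frontier S. \<forall>t. l \<bullet> z \<le> \<beta> + real k + 1 \<and> 0 \<le> t \<and> t \<le> \<epsilon> \<longrightarrow> z + t *\<^sub>R e \<in> N"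
  proof
    fix k
    let ?K = "frontier S \<inter> {x. l \<bullet> x \<le> \<beta> + real k + 1}"
    have "bounded ?K"
    proof (rule bounded_subset)
      show "bounded (closure (S \<inter> {x. l \<bullet> x \<le> \<beta> + real k + 2}))" using bd bounded_closure by blast
      \<comment> \<open>The bound is relaxed from 1 to 2 because a frontier point is only a limit of
        points of \<open>S\<close>, whose \<open>l\<close>-values may be slightly larger.\<close>
      show "?K \<subseteq> closure (S \<inter> {x. l \<bullet> x \<le> \<beta> + real k + 2})"
      proof
        fix x assume x: "x \<in> ?K"
        hence "x \<in> {x. l \<bullet> x < \<beta> + real k + 2} \<inter> closure S" by (auto simp: frontier_def)
        hence "x \<in> closure ({x. l \<bullet> x < \<beta> + real k + 2} \<inter> S)"
          using open_Int_closure_subset[OF open_halfspace_lt] by blast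
        moreover have "{x. l \<bullet> x < \<beta> + real k + 2} \<inter> S \<subseteq> S \<inter> {x. l \<bullet> x \<le> \<beta> + real k + 2}" by auto
        ultimately show "x \<in> closure (S \<inter> {x. l \<bullet> x \<le> \<beta> + real k + 2})"
          using closure_mono by blast
      qed
    qed
    moreover have "closed ?K" by (intro closed_Int closed_halfspace_le) auto
    ultimately have "compact ?K" by (simp add: compact_eq_bounded_closed)
    then obtain d where d: "d > 0" "(\<Union>x\<in>?K. ball x d) \<subseteq> N"
      using compact_subset_open_imp_ball_epsilon_subset[of ?K N] N by auto
    have "z + t *\<^sub>R e \<in> N" if "z \<in> ?K" "0 \<le> t" "t \<le> d / (2 * norm e)" for z t
    proof -
      have "t * norm e \<le> d / 2" using that e0 by (simp add: field_simps)
      hence "z + t *\<^sub>R e \<in> ball z d" using that d(1) by (simp add: dist_norm)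
      thus ?thesis using d(2) that(1) by blast
    qed
    thus "\<exists>\<epsilon>>0. \<forall>z\<in>frontier S. \<forall>t. l \<bullet> z \<le> \<beta> + real k + 1 \<and> 0 \<le> t \<and> t \<le> \<epsilon> \<longrightarrow> z + t *\<^sub>R e \<in> N"
      using d(1) e0 by (intro exI[of _ "d / (2 * norm e)"]) auto
  qed
  from choice[OF this] obtain \<delta> where \<delta>: "\<And>k. 0 < \<delta> k"
    "\<And>k z t. z \<in> frontier S \<Longrightarrow> l \<bullet> z \<le> \<beta> + real k + 1 \<Longrightarrow> 0 \<le> t \<Longrightarrow> t \<le> \<delta> k \<Longrightarrow> z + t *\<^sub>R e \<in> N"
    by blast
  obtain \<kappa>0 :: "real \<Rightarrow> real" where \<kappa>0: "\<And>t. 0 < \<kappa>0 t" "convex_on UNIV \<kappa>0" "antimono \<kappa>0"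
    "\<And>k t. real k \<le> t \<Longrightarrow> \<kappa>0 t \<le> \<delta> k"
    using small_decreasing_convex_function[of \<delta>] \<delta>(1) by blast
  define \<kappa> where "\<kappa> p = \<kappa>0 (l \<bullet> p - \<beta>)" for p
  define T where "T p = p - \<kappa> p *\<^sub>R e" for p
  define V where "V = T -` S"
  have kpos: "0 < \<kappa> p" for p by (simp add: \<kappa>_def \<kappa>0)
  have kconv: "\<kappa> ((1 - t) *\<^sub>R p + t *\<^sub>R q) \<le> (1 - t) * \<kappa> p + t * \<kappa> q" if "0 \<le> t" "t \<le> 1" for p q t
  proof -
    have "l \<bullet> ((1 - t) *\<^sub>R p + t *\<^sub>R q) - \<beta> = (1 - t) *\<^sub>R (l \<bullet> p - \<beta>) + t *\<^sub>R (l \<bullet> q - \<beta>)"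
      by (simp add: inner_add_right algebra_simps)
    thus ?thesis unfolding \<kappa>_def using convex_onD[OF \<kappa>0(2) that, of "l \<bullet> p - \<beta>" "l \<bullet> q - \<beta>"] by simp
  qed
  have "continuous_on UNIV \<kappa>0" using \<kappa>0(2) by (intro convex_on_continuous) auto
  moreover have "continuous_on UNIV (\<lambda>p. l \<bullet> p - \<beta>)" by (intro continuous_intros)
  ultimately have "continuous_on UNIV \<kappa>" unfolding \<kappa>_def
    by (rule continuous_on_compose2) simp
  hence contT: "continuous_on UNIV T" unfolding T_def by (intro continuous_intros)
  have openV: "open V" unfolding V_def using contT S(1) by (simp add: open_vimage)
  have clV: "T p \<in> closure S" if "p \<in> closure V" for p
  proof -
    have "closure V \<subseteq> T -` closure S"
      using contT closure_subset[of S] by (intro closure_minimal closed_vimage) (auto simp: V_def)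
    thus ?thesis using that by auto
  qed
  \<comment> \<open>The remainder \<open>s\<close> is the convexity defect of
    \<open>\<kappa>\<close>. Being nonnegative, it moves along \<open>e\<close> and cannot leave
    \<open>S\<close>.\<close>
  have Tconv: "\<exists>s\<ge>0. T ((1 - t) *\<^sub>R p + t *\<^sub>R q) = ((1 - t) *\<^sub>R T p + t *\<^sub>R T q) + s *\<^sub>R e"
    if "0 \<le> t" "t \<le> 1" for p q t
    by (rule exI[of _ "(1 - t) * \<kappa> p + t * \<kappa> q - \<kappa> ((1 - t) *\<^sub>R p + t *\<^sub>R q)"])
      (use kconv[OF that] in \<open>auto simp: T_def algebra_simps\<close>)
  show thesis
  proof
    show "open V" by (rule openV)
    show "convex V"
      unfolding convex_alt
    proof (intro ballI allI impI)
      fix p q and t :: real assume pq: "p \<in> V" "q \<in> V" "0 \<le> t \<and> t \<le> 1"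
      obtain s where "0 \<le> s" "T ((1 - t) *\<^sub>R p + t *\<^sub>R q) = ((1 - t) *\<^sub>R T p + t *\<^sub>R T q) + s *\<^sub>R e"
        using Tconv pq by blast
      moreover have "(1 - t) *\<^sub>R T p + t *\<^sub>R T q \<in> S"
        using pq S(2) by (intro convexD_alt) (auto simp: V_def)
      ultimately show "(1 - t) *\<^sub>R p + t *\<^sub>R q \<in> V"
        using recession_open_convex[OF S(1,2) rayc] by (simp add: V_def)
    qed
    show "closure V \<subseteq> S"
    proof
      fix p assume "p \<in> closure V"
      hence "T p + \<kappa> p *\<^sub>R e \<in> S"
        using recession_strictly_convex[OF S rayc e0 clV kpos] by simp
      thus "p \<in> S" by (simp add: T_def)
    qed
    show "\<not> contains_segment (frontier V)"
    proof
      assume "contains_segment (frontier V)"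
      then obtain p q where pq: "p \<noteq> q" "closed_segment p q \<subseteq> frontier V"
        unfolding contains_segment_def by blast
      define m where "m = (1 - 1/2) *\<^sub>R p + (1/2) *\<^sub>R q"
      have "m \<in> closed_segment p q" unfolding m_def in_segment by (intro exI[of _ "1/2"]) auto
      hence "m \<notin> V" using pq(2) openV by (auto simp: frontier_def interior_open)
      have Tpq: "T p \<in> closure S" "T q \<in> closure S"
        using pq(2) clV by (auto simp: frontier_def)
      show False
      \<comment> \<open>Distinct images have their midpoint in \<open>S\<close> by strict convexity.
        Equal images make \<open>p - q\<close> a multiple of \<open>e\<close> with
        \<open>l\<close>-values differing exactly as \<open>\<kappa> p\<close> and
        \<open>\<kappa> q\<close>; as \<open>\<kappa>\<close> decreases with \<open>l\<close>, the
        multiple is zero.\<close>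
      proof (cases "T p = T q")
        case False
        have "(1 - 1/2) *\<^sub>R T p + (1/2) *\<^sub>R T q \<in> open_segment (T p) (T q)"
          unfolding in_segment using False by (intro conjI exI[of _ "1/2"]) auto
        hence "(1 - 1/2) *\<^sub>R T p + (1/2) *\<^sub>R T q \<in> S"
          using open_segment_subset_strictly_convex[OF S Tpq] by blast
        moreover obtain s where "0 \<le> s" "T m = ((1 - 1/2) *\<^sub>R T p + (1/2) *\<^sub>R T q) + s *\<^sub>R e"
          using Tconv[of "1/2" p q] unfolding m_def by auto
        ultimately have "T m \<in> S"
          using recession_open_convex[OF S(1,2) rayc] by simp
        thus False using \<open>m \<notin> V\<close> by (simp add: V_def)
      next
        case True
        hence eq: "p - q = (\<kappa> p - \<kappa> q) *\<^sub>R e" by (simp add: T_def algebra_simps)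
        hence "l \<bullet> p - l \<bullet> q = \<kappa> p - \<kappa> q" using le by (simp flip: inner_diff_right)
        moreover have "\<kappa> p \<le> \<kappa> q" if "l \<bullet> q \<le> l \<bullet> p"
          using that antimonoD[OF \<kappa>0(3)] by (simp add: \<kappa>_def)
        moreover have "\<kappa> q \<le> \<kappa> p" if "l \<bullet> p \<le> l \<bullet> q"
          using that antimonoD[OF \<kappa>0(3)] by (simp add: \<kappa>_def)
        ultimately have "\<kappa> p = \<kappa> q" by linarith
        thus False using eq pq(1) by simp
      qed
    qed
    \<comment> \<open>Wherever \<open>l\<close> is at least \<open>\<beta>\<close>,
      \<open>\<kappa>\<close> is at most \<open>\<kappa>0 0\<close>, so a single translation by that
      amount along \<open>e\<close> compensates every shift.\<close>
    show "\<exists>w. (+) w ` S \<subseteq> V"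
    proof (intro exI[of _ "\<kappa>0 0 *\<^sub>R e"] subsetI)
      fix y assume "y \<in> (+) (\<kappa>0 0 *\<^sub>R e) ` S"
      then obtain p where p: "p \<in> S" "y = \<kappa>0 0 *\<^sub>R e + p" by auto
      have "l \<bullet> y - \<beta> \<ge> 0" using lb[OF p(1)] le p(2) \<kappa>0(1)[of 0] by (simp add: inner_add_right)
      hence "\<kappa> y \<le> \<kappa>0 0" unfolding \<kappa>_def by (rule antimonoD[OF \<kappa>0(3)])
      hence "p + (\<kappa>0 0 - \<kappa> y) *\<^sub>R e \<in> S" by (intro recession_open_convex[OF S(1,2) rayc p(1)]) auto
      thus "y \<in> V" by (simp add: V_def T_def p(2) algebra_simps)
    qed
    show "S - V \<subseteq> N"
    proof
      fix p assume p: "p \<in> S - V"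
      \<comment> \<open>Going back along \<open>e\<close> from \<open>p\<close> to
        \<open>T p\<close> crosses the frontier at some \<open>z\<close>. With \<open>k\<close> the
        slice of \<open>z\<close>, the parameter of the crossing is at most
        \<open>\<kappa> p \<le> \<delta> k\<close>, because \<open>l\<close> is not smaller at
        \<open>p\<close> than at \<open>z\<close>.\<close>
      let ?I = "closed_segment (T p) p"
      have "?I \<inter> S \<noteq> {}" "?I - S \<noteq> {}" using p by (auto simp: V_def)
      then obtain z where z: "z \<in> ?I" "z \<in> frontier S"
        using connected_Int_frontier[of ?I S] by auto
      then obtain u where u: "0 \<le> u" "u \<le> 1" "z = (1 - u) *\<^sub>R T p + u *\<^sub>R p"
        by (auto simp: in_segment)
      define t where "t = (1 - u) * \<kappa> p"
      have t: "0 \<le> t" "t \<le> \<kappa> p" "p = z + t *\<^sub>R e"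
        using u kpos[of p] by (auto simp: t_def T_def algebra_simps intro!: mult_left_le)
      have lz: "\<beta> \<le> l \<bullet> z" using z(2) lbc by (auto simp: frontier_def)
      define k where "k = nat \<lfloor>l \<bullet> z - \<beta>\<rfloor>"
      have k: "real k \<le> l \<bullet> z - \<beta>" "l \<bullet> z - \<beta> \<le> real k + 1" using lz unfolding k_def by linarith+
      have "l \<bullet> z \<le> l \<bullet> p" using t le by (simp add: inner_add_right)
      hence "\<kappa> p \<le> \<delta> k" unfolding \<kappa>_def using k by (intro \<kappa>0(4)) auto
      thus "p \<in> N" using \<delta>(2)[OF z(2), of k t] t k by simp
    qed
  qed
qed

section \<open>Continuity up to the hole\<close>

text \<open>The line runs in a supporting hyperplane through \<open>y\<close>, whose normal has an
  orthogonal direction in dimension at least two; openness of \<open>S\<close> turns weak separation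
  into disjointness.\<close>

lemma line_avoiding_convex:
  fixes S :: "'a::euclidean_space set"
  assumes "2 \<le> DIM('a)" "open S" "convex S" "y \<notin> S"
  obtains v where "norm v = 1" "\<And>t. y + t *\<^sub>R v \<notin> S"
proof -
  have "convex ((\<lambda>x. x - y) ` S)" "0 \<notin> (\<lambda>x. x - y) ` S"
    using assms(3,4) by (auto simp: convex_translation_subtract_eq)
  from separating_hyperplane_set_0[OF this] obtain a
    where a: "a \<noteq> 0" "\<forall>x\<in>(\<lambda>x. x - y) ` S. 0 \<le> a \<bullet> x" by blast
  obtain v where v: "v \<noteq> 0" "orthogonal a v"
    using orthogonal_to_vector_exists[OF assms(1), of a] by auto
  have notin: "y + t *\<^sub>R v \<notin> S" for t
  proof
    assume "y + t *\<^sub>R v \<in> S"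
    then obtain r where r: "r > 0" "ball (y + t *\<^sub>R v) r \<subseteq> S"
      using assms(2) open_contains_ball by blast
    have "y + t *\<^sub>R v - (r / (2 * norm a)) *\<^sub>R a \<in> ball (y + t *\<^sub>R v) r"
      using a(1) r(1) by (simp add: dist_norm)
    hence "0 \<le> a \<bullet> (y + t *\<^sub>R v - (r / (2 * norm a)) *\<^sub>R a - y)"
      using a(2) r(2) by blast
    also have "\<dots> = - (r / (2 * norm a)) * (a \<bullet> a)"
      using v(2) by (simp add: inner_add_right inner_diff_right orthogonal_def)
    also have "\<dots> < 0" using a(1) r(1) by simp
    finally show False by simp
  qed
  have "y + t *\<^sub>R (v /\<^sub>R norm v) \<notin> S" for t using notin[of "t / norm v"] by (simp add: divide_inverse)
  thus thesis using that[of "v /\<^sub>R norm v"] v(1) by simp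
qed

text \<open>A second point of the closure on the line would put the midpoint into \<open>S\<close>,
  which the line misses.\<close>

lemma tangent_not_in_closure:
  fixes S :: "'a::euclidean_space set"
  assumes "open S" "convex S" "\<not> contains_segment (frontier S)"
    and "z \<in> closure S" "\<And>t. z + t *\<^sub>R v \<notin> S" "v \<noteq> 0" "t \<noteq> 0"
  shows "z + t *\<^sub>R v \<notin> closure S"
proof
  assume "z + t *\<^sub>R v \<in> closure S"
  hence "open_segment z (z + t *\<^sub>R v) \<subseteq> S"
    using open_segment_subset_strictly_convex assms by blast
  moreover have "z + (t/2) *\<^sub>R v \<in> open_segment z (z + t *\<^sub>R v)"
    unfolding in_segment using assms(6,7)
    by (intro conjI exI[of _ "1/2"]) (auto simp: algebra_simps simp flip: scaleR_add_left)
  ultimately show False using assms(5) by blast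
qed

lemma segment_on_line:
  "closed_segment (z + r *\<^sub>R v) (z + s *\<^sub>R v) \<subseteq> (\<lambda>t. z + t *\<^sub>R v) ` closed_segment r s"
proof
  fix x assume "x \<in> closed_segment (z + r *\<^sub>R v) (z + s *\<^sub>R v)"
  then obtain u where u: "0 \<le> u" "u \<le> 1" "x = (1 - u) *\<^sub>R (z + r *\<^sub>R v) + u *\<^sub>R (z + s *\<^sub>R v)"
    by (auto simp: in_segment)
  have "x = z + ((1 - u) *\<^sub>R r + u *\<^sub>R s) *\<^sub>R v" by (simp add: u(3) algebra_simps)
  moreover have "(1 - u) *\<^sub>R r + u *\<^sub>R s \<in> closed_segment r s" using u(1,2) by (auto simp: in_segment)
  ultimately show "x \<in> (\<lambda>t. z + t *\<^sub>R v) ` closed_segment r s" by (rule image_eqI)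
qed

lemma segment_concave_on_isCont:
  fixes g :: "'a::euclidean_space \<Rightarrow> real"
  assumes "segment_concave_on T g" "ball w r \<subseteq> T" "0 < r"
  shows "isCont g w"
proof -
  have "concave_on (ball w r) g"
    using segment_concave_on_subset[OF assms(1,2)] by (simp add: segment_concave_on_iff_concave_on)
  hence "continuous_on (ball w r) (\<lambda>x. - g x)"
    unfolding concave_on_def by (intro convex_on_continuous) auto
  hence "continuous_on (ball w r) (\<lambda>x. - (- g x))" by (rule continuous_on_minus)
  thus ?thesis using assms(3) by (simp add: continuous_on_eq_continuous_at)
qed

text \<open>At a boundary point \<open>z\<close> of the hole, \<open>g\<close> is compared with its values on a line through a
  nearby point that misses the hole; such lines accumulate at a supporting line at \<open>z\<close>, which
  leaves the closure of the hole except at \<open>z\<close>.\<close>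

lemma segment_concave_on_continuous:
  fixes g :: "'a::euclidean_space \<Rightarrow> real"
  assumes dim: "2 \<le> DIM('a)" and S: "open S" "convex S" "\<not> contains_segment (frontier S)"
    and U: "open U" and g: "segment_concave_on (U - S) g"
  shows "continuous_on (U - S) g"
  unfolding continuous_on_eq_continuous_within
proof
  fix z assume z: "z \<in> U - S"
  have cont: "isCont g w" if w: "w \<in> U - closure S" for w
  proof -
    have "open (U - closure S)" using U by blast
    then obtain r where "r > 0" "ball w r \<subseteq> U - closure S"
      using w open_contains_ball by blast
    thus ?thesis
      using closure_subset[of S] by (intro segment_concave_on_isCont[OF g, of w r]) auto
  qed
  show "continuous (at z within U - S) g"
  proof (cases "z \<in> closure S")
    case False
    thus ?thesis using cont[of z] z by (auto intro: continuous_at_imp_continuous_within)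
  next
    case zcl: True
    obtain R where R: "R > 0" "ball z R \<subseteq> U" using z U open_contains_ball by blast
    show ?thesis
    proof (rule ccontr)
      assume "\<not> ?thesis"
      then obtain e where e: "e > 0"
        "\<And>d. d > 0 \<Longrightarrow> \<exists>y\<in>U - S. dist y z < d \<and> \<not> dist (g y) (g z) < e"
        unfolding continuous_within_eps_delta by blast
      have "\<forall>n. \<exists>y. y \<in> U - S \<and> dist y z < inverse (real (Suc n)) \<and> e \<le> dist (g y) (g z)"
        using e(2)[of "inverse (real (Suc n))" for n] by (metis inverse_positive_iff_positive not_less of_nat_0_less_iff zero_less_Suc)
      from choice[OF this] obtain y where y: "\<And>n. y n \<in> U - S"
        "\<And>n. dist (y n) z < inverse (real (Suc n))" "\<And>n. e \<le> dist (g (y n)) (g z)" by blast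
      have ylim: "y \<longlonglongrightarrow> z"
      proof (rule metric_LIMSEQ_I)
        fix r :: real assume "r > 0"
        then obtain m where m: "inverse (real (Suc m)) < r" using reals_Archimedean by blast
        have "dist (y n) z < r" if "m \<le> n" for n
        proof -
          have "inverse (real (Suc n)) \<le> inverse (real (Suc m))" using that by (intro le_imp_inverse_le) auto
          thus ?thesis using y(2)[of n] m by linarith
        qed
        thus "\<exists>no. \<forall>n\<ge>no. dist (y n) z < r" by blast
      qed
      \<comment> \<open>Each \<open>y n\<close> gets its own line missing the hole. A limiting
        direction gives a line through \<open>z\<close> that still misses it, because the complement
        of \<open>S\<close> is closed.\<close>
      have "\<forall>n. \<exists>v. norm v = 1 \<and> (\<forall>t. y n + t *\<^sub>R v \<notin> S)"
        using line_avoiding_convex[OF dim S(1,2)] y(1) by (metis DiffD2)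
      from choice[OF this] obtain v where v: "\<And>n. norm (v n) = 1" "\<And>n t. y n + t *\<^sub>R v n \<notin> S"
        by blast
      have "\<forall>n. v n \<in> sphere 0 1" using v(1) by simp
      then obtain w r where w: "w \<in> sphere (0::'a) 1" "strict_mono r" "(v \<circ> r) \<longlonglongrightarrow> w"
        using compact_imp_seq_compact[OF compact_sphere[of "0::'a" 1], THEN seq_compactE, of v]
        by metis
      have yr: "(\<lambda>n. y (r n)) \<longlonglongrightarrow> z" using LIMSEQ_subseq_LIMSEQ[OF ylim w(2)] by (simp add: o_def)
      have lim: "(\<lambda>n. y (r n) + t *\<^sub>R v (r n)) \<longlonglongrightarrow> z + t *\<^sub>R w" for t
        using w(3) by (intro tendsto_intros yr) (simp add: o_def)
      have zw: "z + t *\<^sub>R w \<notin> S" for t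
        using closed_sequentially[OF _ _ lim[of t], of "- S"] v(2) S(1) by (auto simp: closed_def)
      have w0: "w \<noteq> 0" "norm w = 1" using w(1) by auto
      have inU: "z + t *\<^sub>R w \<in> U" if "\<bar>t\<bar> < R" for t
        using that R(2) w0(2) by (auto simp: dist_norm subset_iff)
      \<comment> \<open>For \<open>t \<noteq> 0\<close> the limit points lie off the closed hole,
        where \<open>g\<close> is already known to be continuous.\<close>
      have conv: "(\<lambda>n. g (y (r n) + t *\<^sub>R v (r n))) \<longlonglongrightarrow> g (z + t *\<^sub>R w)" if "t \<noteq> 0" "\<bar>t\<bar> < R" for t
        using tangent_not_in_closure[OF S zcl zw w0(1) that(1)] inU[OF that(2)]
        by (intro isCont_tendsto_compose[OF cont lim]) auto
      \<comment> \<open>Along the limiting line, one-dimensional concavity gives continuity at 0.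
        This yields \<open>s\<close> with \<open>\<phi>\<close> nearly equal to
        \<open>\<phi> 0\<close> at \<open>-s\<close>, \<open>s\<close> and
        \<open>2 s\<close>.\<close>
      define \<phi> where "\<phi> t = g (z + t *\<^sub>R w)" for t
      have "segment_concave_on (ball 0 R) \<phi>"
        unfolding segment_concave_on_def
      proof (intro allI impI concave_onI)
        fix a b s s' t :: real
        assume ab: "closed_segment a b \<subseteq> ball 0 R"
          and *: "s \<in> closed_segment a b" "s' \<in> closed_segment a b" "0 \<le> t" "t \<le> 1"
        have "closed_segment s s' \<subseteq> ball 0 R" using ab * subset_closed_segment by blast
        hence "closed_segment (z + s *\<^sub>R w) (z + s' *\<^sub>R w) \<subseteq> U - S"
          using segment_on_line[of z s w s'] zw inU by (force simp: dist_real_def)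
        from segment_concave_onD[OF g this *(3,4)]
        show "(1 - t) * \<phi> s + t * \<phi> s' \<le> \<phi> ((1 - t) *\<^sub>R s + t *\<^sub>R s')"
          by (simp add: \<phi>_def algebra_simps)
      qed simp
      hence "isCont \<phi> 0" using R(1) by (intro segment_concave_on_isCont[of "ball 0 R"]) auto
      then obtain d where d: "d > 0" "\<And>t. dist t 0 < d \<Longrightarrow> dist (\<phi> t) (\<phi> 0) < e / 4"
        using e(1) unfolding continuous_at_eps_delta by (metis divide_pos_pos zero_less_numeral)
      define s where "s = min d R / 4"
      have s: "0 < s" "2 * s < d" "2 * s \<le> R / 2" using d R by (auto simp: s_def)
      have phi: "\<bar>\<phi> s - \<phi> 0\<bar> < e / 4" "\<bar>\<phi> (-s) - \<phi> 0\<bar> < e / 4" "\<bar>\<phi> (2 * s) - \<phi> 0\<bar> < e / 4"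
        using d(2)[of s] d(2)[of "-s"] d(2)[of "2 * s"] s by (auto simp: dist_real_def)
      have "\<phi> 0 - e / 4 < \<phi> s" "\<phi> 0 - e / 4 < \<phi> (-s)"
        using phi(1,2)[unfolded abs_diff_less_iff] by (blast, blast)
      hence low: "\<phi> 0 - e < (\<phi> s + \<phi> (-s)) / 2" using e(1) by argo
      have "\<forall>\<^sub>F n in sequentially. dist (y (r n)) z < R / 2"
        using yr R(1) by (intro tendstoD) auto
      \<comment> \<open>Since \<open>y + s v\<close> is the midpoint of \<open>y\<close> and
        \<open>y + 2 s v\<close>, this expression bounds \<open>g y\<close> from above. The mean of
        the values at \<open>y + s v\<close> and \<open>y - s v\<close>, used next, bounds it from
        below.\<close>
      moreover have "(\<lambda>n. 2 * g (y (r n) + s *\<^sub>R v (r n)) - g (y (r n) + (2 * s) *\<^sub>R v (r n)))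
          \<longlonglongrightarrow> 2 * \<phi> s - \<phi> (2 * s)"
        unfolding \<phi>_def using s by (intro tendsto_intros conv) auto
      hence "\<forall>\<^sub>F n in sequentially. 2 * g (y (r n) + s *\<^sub>R v (r n)) - g (y (r n) + (2 * s) *\<^sub>R v (r n)) < \<phi> 0 + e"
        by (rule order_tendstoD) (use phi in linarith)
      moreover have "(\<lambda>n. (g (y (r n) + s *\<^sub>R v (r n)) + g (y (r n) + (-s) *\<^sub>R v (r n))) / 2)
          \<longlonglongrightarrow> (\<phi> s + \<phi> (-s)) / 2"
        unfolding \<phi>_def using s by (intro tendsto_intros conv) auto
      hence "\<forall>\<^sub>F n in sequentially. \<phi> 0 - e < (g (y (r n) + s *\<^sub>R v (r n)) + g (y (r n) + (-s) *\<^sub>R v (r n))) / 2"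
        by (rule order_tendstoD) (rule low)
      ultimately have "\<forall>\<^sub>F n in sequentially. dist (g (y (r n))) (g z) < e"
      proof eventually_elim
        case (elim n)
        define p q where "p = y (r n)" and "q = v (r n)"
        have inU': "p + t *\<^sub>R q \<in> U - S" if "\<bar>t\<bar> \<le> R / 2" for t
        proof -
          have "dist (p + t *\<^sub>R q) z \<le> dist (p + t *\<^sub>R q) p + dist p z" by (rule dist_triangle)
          also have "\<dots> < R" using elim(1) that v(1) by (simp add: dist_norm p_def q_def)
          finally show ?thesis using R(2) v(2) by (auto simp: dist_commute p_def q_def)
        qed
        have "closed_segment (p + 0 *\<^sub>R q) (p + (2 * s) *\<^sub>R q) \<subseteq> U - S"
          using segment_on_line[of p 0 q "2 * s"] s inU'
          by (force simp: closed_segment_eq_real_ivl)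
        from segment_concave_onD[OF g this, of "1/2"]
        have "(1 - 1/2) * g p + 1/2 * g (p + (2 * s) *\<^sub>R q) \<le> g (p + s *\<^sub>R q)"
          by (simp add: algebra_simps flip: scaleR_add_left)
        moreover have "closed_segment (p + s *\<^sub>R q) (p + (-s) *\<^sub>R q) \<subseteq> U - S"
          using segment_on_line[of p s q "-s"] s inU'
          by (force simp: closed_segment_eq_real_ivl)
        from segment_concave_onD[OF g this, of "1/2"]
        have "(1 - 1/2) * g (p + s *\<^sub>R q) + 1/2 * g (p + (-s) *\<^sub>R q) \<le> g p"
          by (simp add: algebra_simps flip: scaleR_add_left)
        ultimately show ?case using elim(2,3) by (auto simp: p_def q_def dist_real_def \<phi>_def)
      qed
      then obtain n where "dist (g (y (r n))) (g z) < e"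
        using eventually_happens by fastforce
      thus False using y(3)[of "r n"] by linarith
    qed
  qed
qed

text \<open>The other end cannot compensate, as its value is not \<open>-\<infinity>\<close>.
  Infinite values thus spread along segments.\<close>

lemma locally_concave_on_infinity:
  assumes "locally_concave_on \<omega> G" "closed_segment a b \<subseteq> \<omega>" "G a = \<infinity>" "u \<in> open_segment a b"
  shows "G u = \<infinity>"
proof -
  obtain t where t: "0 < t" "t < 1" "u = (1 - t) *\<^sub>R a + t *\<^sub>R b" using assms(4) by (auto simp: in_segment)
  have "ereal_concave_on (closed_segment a b) G" "G b \<noteq> -\<infinity>"
    using assms unfolding locally_concave_on_def by auto
  hence "ereal (1 - t) * G a + ereal t * G b \<le> G u"
    unfolding ereal_concave_on_def t(3) using t by auto
  moreover have "ereal (1 - t) * G a = \<infinity>" using t assms(3) by simp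
  moreover have "ereal t * G b \<noteq> -\<infinity>" using \<open>G b \<noteq> -\<infinity>\<close> t by (cases "G b") auto
  ultimately show ?thesis by (cases "ereal t * G b") auto
qed

section \<open>Finiteness\<close>

text \<open>Moving along \<open>- e\<close> from a point outside \<open>C\<close> never enters
  \<open>C\<close>, since \<open>e\<close> is a recession direction, and ends in a half-space
  disjoint from \<open>C\<close>. All these rays are joined through that half-space.\<close>

lemma connected_complement_closed_convex:
  fixes C :: "'a::euclidean_space set"
  assumes "closed C" "convex C" and ray: "\<And>t. 0 \<le> t \<Longrightarrow> p0 + t *\<^sub>R e \<in> C"
    and le: "l \<bullet> e > 0" and lb: "\<And>x. x \<in> C \<Longrightarrow> \<beta> \<le> l \<bullet> x"
  shows "connected (- C)"
proof -
  let ?H = "{x. l \<bullet> x < \<beta>}"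
  let ?R = "\<lambda>p. (\<lambda>t. p - t *\<^sub>R e) ` {0..}"
  have R: "?R p \<subseteq> - C" if "p \<in> - C" for p
  proof safe
    fix t :: real assume "0 \<le> t" "p - t *\<^sub>R e \<in> C"
    hence "p - t *\<^sub>R e + t *\<^sub>R e \<in> C" by (intro recession_closed_convex[OF assms(1,2) ray])
    thus False using that by simp
  qed
  have meet: "?R p \<inter> ?H \<noteq> {}" for p
  proof -
    define t where "t = max 0 ((l \<bullet> p - \<beta>) / (l \<bullet> e) + 1)"
    have "(l \<bullet> p - \<beta>) / (l \<bullet> e) < t" by (simp add: t_def)
    hence "l \<bullet> p - \<beta> < t * (l \<bullet> e)" using le by (simp add: pos_divide_less_eq)
    hence "p - t *\<^sub>R e \<in> ?H" by (simp add: inner_diff_right)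
    moreover have "0 \<le> t" by (simp add: t_def)
    ultimately show ?thesis by blast
  qed
  have "connected (?R p)" for p
    by (intro connected_continuous_image continuous_intros convex_connected) simp
  moreover have "connected ?H" by (intro convex_connected convex_halfspace_lt)
  ultimately have "connected (?H \<union> (\<Union>p\<in>- C. ?R p))"
    using meet by (intro connected_Un_UN; blast)
  moreover have "?H \<union> (\<Union>p\<in>- C. ?R p) = - C"
  proof
    show "?H \<union> (\<Union>p\<in>- C. ?R p) \<subseteq> - C" using R lb by force
    have "p \<in> ?R p" for p by (rule image_eqI[of _ _ 0]) auto
    thus "- C \<subseteq> ?H \<union> (\<Union>p\<in>- C. ?R p)" by blast
  qed
  ultimately show ?thesis by simp
qed

text \<open>The complement of \<open>C\<close> is pushed into \<open>U\<close> along the normal segments to \<open>C\<close>.\<close>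

lemma connected_diff_closed_convex:
  fixes U C :: "'a::euclidean_space set"
  assumes "open U" "convex U" "closed C" "convex C" "C \<noteq> {}" "C \<subseteq> U" "U \<noteq> UNIV"
    and conn: "connected (- C)"
  shows "connected (U - C)"
proof -
  define c where "c = closest_point C"
  define r where "r p = infdist (c p) (- U)" for p
  \<comment> \<open>With \<open>d\<close> the distance from \<open>p\<close> to \<open>c p\<close>,
    the factor reduces it to \<open>d r / (d + r) < r\<close>, which is too short to leave
    \<open>U\<close>.\<close>
  define \<rho> where "\<rho> p = c p + (r p / (norm (p - c p) + r p)) *\<^sub>R (p - c p)" for p
  have cC: "c p \<in> C" for p unfolding c_def using assms by (intro closest_point_in_set)
  have rpos: "r p > 0" for p
  proof -
    have "c p \<notin> closure (- U)" using cC[of p] assms(1,6) by (auto simp: closure_interior interior_open)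
    moreover have "- U \<noteq> {}" using assms(7) by auto
    ultimately have "r p \<noteq> 0" unfolding r_def using in_closure_iff_infdist_zero by blast
    thus ?thesis using infdist_nonneg[of "c p" "- U"] by (simp add: r_def)
  qed
  \<comment> \<open>At the closest point \<open>c p\<close> the angle between \<open>p\<close> and
    any point of \<open>C\<close> is not acute, so the normal ray through \<open>p\<close> meets
    \<open>C\<close> only at its origin.\<close>
  have beyond: "c p + s *\<^sub>R (p - c p) \<notin> C" if "p \<notin> C" "s > 0" for p s
  proof
    assume q: "c p + s *\<^sub>R (p - c p) \<in> C"
    have "(p - c p) \<bullet> (c p + s *\<^sub>R (p - c p) - c p) \<le> 0"
      unfolding c_def using q assms(3,4) unfolding c_def by (intro closest_point_dot) auto
    hence "s * ((p - c p) \<bullet> (p - c p)) \<le> 0" by simp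
    hence "(p - c p) \<bullet> (p - c p) \<le> 0" using that(2) by (simp add: mult_le_0_iff)
    hence "p = c p" by (metis inner_gt_zero_iff not_less eq_iff_diff_eq_0)
    thus False using cC[of p] that(1) by simp
  qed
  have cont: "continuous_on UNIV c"
    unfolding c_def using assms by (intro continuous_on_closest_point)
  have contr: "continuous_on UNIV r" unfolding r_def by (intro continuous_intros cont)
  have "norm (p - c p) + r p \<noteq> 0" for p using rpos[of p] norm_ge_zero[of "p - c p"] by linarith
  hence cont\<rho>: "continuous_on (- C) \<rho>"
    unfolding \<rho>_def
    by (intro continuous_intros continuous_on_subset[OF cont] continuous_on_subset[OF contr]) auto
  have \<rho>U: "\<rho> p \<in> U" for p
  proof (rule ccontr)
    assume "\<rho> p \<notin> U"
    hence "r p \<le> dist (c p) (\<rho> p)" unfolding r_def by (intro infdist_le) simp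
    also have "\<dots> = r p / (norm (p - c p) + r p) * norm (p - c p)"
      using rpos[of p] by (simp add: \<rho>_def dist_norm)
    also have "\<dots> < r p / (norm (p - c p) + r p) * (norm (p - c p) + r p)"
      using rpos[of p] by (intro mult_strict_left_mono divide_pos_pos add_nonneg_pos) auto
    also have "\<dots> = r p" using \<open>norm (p - c p) + r p \<noteq> 0\<close> by simp
    finally show False by simp
  qed
  have \<rho>C: "\<rho> p \<notin> C" if "p \<notin> C" for p
    unfolding \<rho>_def using rpos[of p] by (intro beyond that divide_pos_pos add_nonneg_pos) auto
  have seg: "closed_segment p (\<rho> p) \<subseteq> U - C" if p: "p \<in> U - C" for p
  proof
    fix x assume x: "x \<in> closed_segment p (\<rho> p)"
    have xU: "x \<in> U" using x p \<rho>U[of p] assms(2) closed_segment_subset by blast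
    obtain u where u: "0 \<le> u" "u \<le> 1" "x = (1 - u) *\<^sub>R p + u *\<^sub>R \<rho> p"
      using x by (auto simp: in_segment)
    define k where "k = r p / (norm (p - c p) + r p)"
    have k: "k > 0" unfolding k_def using rpos[of p] by (intro divide_pos_pos add_nonneg_pos) auto
    have "x = c p + ((1 - u) + u * k) *\<^sub>R (p - c p)"
      unfolding u(3) \<rho>_def k_def[symmetric] by (simp add: algebra_simps)
    moreover have "(1 - u) + u * k > 0"
      using u k by (cases "u = 1") (auto intro: add_pos_nonneg)
    ultimately have "x \<notin> C" using beyond p by auto
    thus "x \<in> U - C" using xU by simp
  qed
  have "connected (\<rho> ` (- C))" by (rule connected_continuous_image[OF cont\<rho> conn])
  moreover have "closed_segment p (\<rho> p) \<inter> \<rho> ` (- C) \<noteq> {}" if "p \<in> U - C" for p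
    using ends_in_segment(2)[of "\<rho> p" p] that by blast
  moreover have "connected (closed_segment p (\<rho> p))" for p by simp
  ultimately have "connected (\<rho> ` (- C) \<union> (\<Union>p\<in>U - C. closed_segment p (\<rho> p)))"
    by (intro connected_Un_UN; blast)
  moreover have "\<rho> ` (- C) \<union> (\<Union>p\<in>U - C. closed_segment p (\<rho> p)) = U - C"
    using \<rho>U \<rho>C seg by auto
  ultimately show ?thesis by simp
qed

text \<open>In the connected set \<open>U - closure S\<close> the points of infinite value form an
  open set with relatively open complement. An infinite value at \<open>y\<close> is carried into
  this set along a segment, hence fills it, and is then carried to \<open>x\<close>.\<close>

lemma locally_concave_on_finite:
  fixes G :: "'a::euclidean_space \<Rightarrow> ereal"
  assumes dim: "2 \<le> DIM('a)" and U: "open U" "convex U"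
    and S: "open S" "convex S" "\<not> contains_segment (frontier S)" "closure S \<subseteq> U"
    and conn: "connected (U - closure S)"
    and G: "locally_concave_on (closure U - S) G"
    and x: "x \<in> U - S" "G x \<noteq> \<infinity>" and y: "y \<in> closure U - S"
  shows "G y \<noteq> \<infinity>"
proof
  assume Gy: "G y = \<infinity>"
  let ?O = "U - closure S"
  have openO: "open ?O" using U by blast
  have UO: "?O \<subseteq> closure U - S" "U - S \<subseteq> closure U - S" using closure_subset by blast+
  \<comment> \<open>A short segment of a supporting line, centred at a frontier point of the hole,
    lies in the domain and, apart from its centre, off the closed hole. It links such a point with
    the connected open part.\<close>
  have tang: "\<exists>v. v \<noteq> 0 \<and> (\<forall>t. \<bar>t\<bar> \<le> 1 \<longrightarrow> z + t *\<^sub>R v \<in> U - S \<and> (t \<noteq> 0 \<longrightarrow> z + t *\<^sub>R v \<in> ?O))"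
    if z: "z \<in> U - S" "z \<in> closure S" for z
  proof -
    obtain v where v: "norm v = 1" "\<And>t. z + t *\<^sub>R v \<notin> S"
      using line_avoiding_convex[OF dim S(1,2)] z(1) by blast
    obtain d where d: "d > 0" "ball z d \<subseteq> U" using U(1) z(1) open_contains_ball by blast
    have "z + t *\<^sub>R ((d/2) *\<^sub>R v) \<in> U - S \<and> (t \<noteq> 0 \<longrightarrow> z + t *\<^sub>R ((d/2) *\<^sub>R v) \<in> ?O)" if "\<bar>t\<bar> \<le> 1" for t
    proof -
      have "\<bar>t\<bar> * (d / 2) < d" using mult_right_mono[OF that, of "d/2"] d(1) by simp
      hence "z + t *\<^sub>R ((d/2) *\<^sub>R v) \<in> ball z d" using v(1) d(1) by (simp add: dist_norm abs_mult)
      moreover have "z + (t * (d/2)) *\<^sub>R v \<notin> closure S" if "t \<noteq> 0"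
        using v d(1) that by (intro tangent_not_in_closure[OF S(1-3) z(2)]) auto
      ultimately show ?thesis using v(2)[of "t * (d/2)"] d(2) by auto
    qed
    thus ?thesis using v(1) d(1) by (intro exI[of _ "(d/2) *\<^sub>R v"]) auto
  qed
  have segt: "closed_segment (z + r *\<^sub>R v) (z + s *\<^sub>R v) \<subseteq> closure U - S"
    if "\<forall>t. \<bar>t\<bar> \<le> 1 \<longrightarrow> z + t *\<^sub>R v \<in> U - S" "\<bar>r\<bar> \<le> 1" "\<bar>s\<bar> \<le> 1" for z v r s
  proof -
    have "\<bar>t\<bar> \<le> 1" if "t \<in> closed_segment r s" for t
      using that \<open>\<bar>r\<bar> \<le> 1\<close> \<open>\<bar>s\<bar> \<le> 1\<close> by (auto simp: closed_segment_eq_real_ivl split: if_splits)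
    thus ?thesis using segment_on_line[of z r v s] that(1) UO(2) by blast
  qed
  have mid: "z + ((r + s) / 2) *\<^sub>R v \<in> open_segment (z + r *\<^sub>R v) (z + s *\<^sub>R v)"
    if "r \<noteq> s" "v \<noteq> 0" for z v :: 'a and r s
    unfolding in_segment using that
    by (intro conjI exI[of _ "1/2"])
      (auto simp: algebra_simps add_divide_distrib simp flip: scaleR_add_left)
  have ex: "\<exists>p\<in>?O. G p = \<infinity>"
  proof (cases "y \<in> U")
    case False
    hence "y \<notin> closure S" using S(4) by auto
    then obtain d where d: "d > 0" "ball y d \<subseteq> - closure S"
      using open_contains_ball[of "- closure S"] by blast
    obtain p where p: "p \<in> U" "dist p y < d"
      using y d(1) closure_approachable[of y U] by blast
    have "closed_segment y p \<subseteq> ball y d"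
      using p(2) d(1) by (intro closed_segment_subset) (auto simp: dist_commute)
    moreover have "closed_segment y p \<subseteq> closure U"
      using y p(1) closure_subset U(2) by (intro closed_segment_subset convex_closure) auto
    ultimately have seg: "closed_segment y p \<subseteq> closure U - S" "closed_segment y p \<inter> closure S = {}"
      using d(2) closure_subset by blast+
    have "y \<noteq> p" using p(1) False by auto
    hence m: "midpoint y p \<in> open_segment y p" by simp
    have "midpoint y p \<in> U"
      using in_interior_closure_convex_segment[OF U(2), of p y] p(1) y m U(1)
      by (auto simp: interior_open open_segment_commute)
    moreover have "midpoint y p \<notin> closure S" using seg(2) m segment_open_subset_closed by blast
    moreover have "G (midpoint y p) = \<infinity>" by (rule locally_concave_on_infinity[OF G seg(1) Gy m])
    ultimately show ?thesis by blast
  next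
    case yU: True
    show ?thesis
    proof (cases "y \<in> closure S")
      case False
      thus ?thesis using Gy yU by blast
    next
      case True
      then obtain v where v: "v \<noteq> 0" "\<forall>t. \<bar>t\<bar> \<le> 1 \<longrightarrow> y + t *\<^sub>R v \<in> U - S \<and> (t \<noteq> 0 \<longrightarrow> y + t *\<^sub>R v \<in> ?O)"
        using tang[of y] y yU by blast
      have "closed_segment (y + 0 *\<^sub>R v) (y + 1 *\<^sub>R v) \<subseteq> closure U - S"
        using v(2) by (intro segt) auto
      moreover have "y + ((0 + 1) / 2) *\<^sub>R v \<in> open_segment (y + 0 *\<^sub>R v) (y + 1 *\<^sub>R v)"
        using v(1) by (intro mid) auto
      ultimately have "G (y + ((0 + 1) / 2) *\<^sub>R v) = \<infinity>"
        using Gy locally_concave_on_infinity[OF G, of "y + 0 *\<^sub>R v" "y + 1 *\<^sub>R v"] by simp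
      thus ?thesis using v(2) by (intro bexI[of _ "y + ((0 + 1) / 2) *\<^sub>R v"]) auto
    qed
  qed
  \<comment> \<open>Both implications use midpoints: \<open>q\<close> is the midpoint of
    \<open>p\<close> and \<open>p + 2 w\<close>, and \<open>p\<close> is the midpoint of
    \<open>q\<close> and \<open>p - w\<close>. The radius is halved to keep \<open>p + 2 w\<close>
    in the ball.\<close>
  have spread: "\<exists>d>0. \<forall>q\<in>ball p d. q \<in> ?O \<and> (G q = \<infinity> \<longleftrightarrow> G p = \<infinity>)" if p: "p \<in> ?O" for p
  proof -
    obtain d where d: "d > 0" "ball p d \<subseteq> ?O" using openO p open_contains_ball by blast
    have "q \<in> ?O \<and> (G q = \<infinity> \<longleftrightarrow> G p = \<infinity>)" if q: "q \<in> ball p (d/2)" for q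
    proof -
      define w where "w = q - p"
      have w: "norm w < d / 2" using q by (simp add: w_def dist_norm norm_minus_commute)
      have inb: "p + t *\<^sub>R w \<in> ball p d" if "\<bar>t\<bar> \<le> 2" for t
      proof -
        have "\<bar>t\<bar> * norm w \<le> 2 * norm w" using that by (intro mult_right_mono) auto
        thus ?thesis using w by (simp add: dist_norm)
      qed
      have seg: "closed_segment (p + r *\<^sub>R w) (p + s *\<^sub>R w) \<subseteq> closure U - S" if "\<bar>r\<bar> \<le> 2" "\<bar>s\<bar> \<le> 2" for r s
      proof -
        have "closed_segment (p + r *\<^sub>R w) (p + s *\<^sub>R w) \<subseteq> ball p d"
          using inb that by (intro closed_segment_subset convex_ball)
        thus ?thesis using d(2) UO(1) by blast
      qed
      have qw: "q = p + 1 *\<^sub>R w" by (simp add: w_def)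
      have 1: "G q = \<infinity>" if "G p = \<infinity>" "w \<noteq> 0"
      proof -
        have "p + ((0 + 2) / 2) *\<^sub>R w \<in> open_segment (p + 0 *\<^sub>R w) (p + 2 *\<^sub>R w)"
          using that by (intro mid) auto
        thus ?thesis
          using locally_concave_on_infinity[OF G seg[of 0 2]] that(1) qw by simp
      qed
      have 2: "G p = \<infinity>" if "G q = \<infinity>" "w \<noteq> 0"
      proof -
        have "p + ((1 + -1) / 2) *\<^sub>R w \<in> open_segment (p + 1 *\<^sub>R w) (p + (-1) *\<^sub>R w)"
          using that by (intro mid) auto
        thus ?thesis
          using locally_concave_on_infinity[OF G seg[of 1 "-1"]] that(1) qw by simp
      qed
      have "q \<in> ball p d" using q d(1) by auto
      hence "q \<in> ?O" using d(2) by blast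
      moreover have "G q = \<infinity> \<longleftrightarrow> G p = \<infinity>" using 1 2 by (cases "w = 0") (auto simp: w_def)
      ultimately show ?thesis by blast
    qed
    hence "\<forall>q\<in>ball p (d/2). q \<in> ?O \<and> (G q = \<infinity> \<longleftrightarrow> G p = \<infinity>)" by blast
    thus ?thesis using half_gt_zero[OF d(1)] by blast
  qed
  have "open {p\<in>?O. G p = \<infinity>}"
    unfolding open_contains_ball
  proof
    fix p assume p: "p \<in> {p\<in>?O. G p = \<infinity>}"
    then obtain d where "d > 0" "\<forall>q\<in>ball p d. q \<in> ?O \<and> (G q = \<infinity> \<longleftrightarrow> G p = \<infinity>)"
      using spread[of p] by blast
    thus "\<exists>d>0. ball p d \<subseteq> {p\<in>?O. G p = \<infinity>}" using p by (intro exI[of _ d]) blast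
  qed
  moreover have "open {p\<in>?O. G p \<noteq> \<infinity>}"
    unfolding open_contains_ball
  proof
    fix p assume p: "p \<in> {p\<in>?O. G p \<noteq> \<infinity>}"
    then obtain d where "d > 0" "\<forall>q\<in>ball p d. q \<in> ?O \<and> (G q = \<infinity> \<longleftrightarrow> G p = \<infinity>)"
      using spread[of p] by blast
    thus "\<exists>d>0. ball p d \<subseteq> {p\<in>?O. G p \<noteq> \<infinity>}" using p by (intro exI[of _ d]) blast
  qed
  moreover have "{p\<in>?O. G p = \<infinity>} \<inter> {p\<in>?O. G p \<noteq> \<infinity>} \<inter> ?O = {}" by blast
  moreover have "?O \<subseteq> {p\<in>?O. G p = \<infinity>} \<union> {p\<in>?O. G p \<noteq> \<infinity>}" by blast
  ultimately have "{p\<in>?O. G p = \<infinity>} \<inter> ?O = {} \<or> {p\<in>?O. G p \<noteq> \<infinity>} \<inter> ?O = {}"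
    using conn connectedD by blast
  hence all: "\<forall>p\<in>?O. G p = \<infinity>" using ex by blast
  have "G x = \<infinity>"
  proof (cases "x \<in> closure S")
    case False
    thus ?thesis using all x(1) by blast
  next
    case True
    then obtain v where v: "v \<noteq> 0" "\<forall>t. \<bar>t\<bar> \<le> 1 \<longrightarrow> x + t *\<^sub>R v \<in> U - S \<and> (t \<noteq> 0 \<longrightarrow> x + t *\<^sub>R v \<in> ?O)"
      using tang[of x] x by blast
    have "closed_segment (x + 1 *\<^sub>R v) (x + (-1) *\<^sub>R v) \<subseteq> closure U - S"
      using v(2) by (intro segt) auto
    moreover have "x + ((1 + -1) / 2) *\<^sub>R v \<in> open_segment (x + 1 *\<^sub>R v) (x + (-1) *\<^sub>R v)"
      using v(1) by (intro mid) auto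
    moreover have "G (x + 1 *\<^sub>R v) = \<infinity>" using all v(2) by (metis abs_one order_refl zero_neq_one)
    ultimately show ?thesis using locally_concave_on_infinity[OF G, of "x + 1 *\<^sub>R v" "x + (-1) *\<^sub>R v"] by simp
  qed
  thus False using x(2) by simp
qed

section \<open>Strong concavity and gluing\<close>

text \<open>For the squared distance to a single point this is an equality. Applied to the point of
  \<open>K\<close> nearest to the combination, it gives the claim, since \<open>infdist\<close> is
  at most the distance to that point.\<close>

lemma infdist_square_semiconcave:
  fixes K :: "'a::euclidean_space set"
  assumes "closed K" "K \<noteq> {}" and that: "0 \<le> t" "t \<le> 1"
  shows "(1 - t) * (infdist x K)\<^sup>2 + t * (infdist y K)\<^sup>2 - t * (1 - t) * (norm (x - y))\<^sup>2
     \<le> (infdist ((1 - t) *\<^sub>R x + t *\<^sub>R y) K)\<^sup>2"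
proof -
  let ?m = "(1 - t) *\<^sub>R x + t *\<^sub>R y"
  obtain z where z: "z \<in> K" "infdist ?m K = dist ?m z"
    using infdist_attains_inf[OF assms(1,2)] by blast
  have le: "(infdist w K)\<^sup>2 \<le> (norm (w - z))\<^sup>2" for w
    using infdist_le[OF z(1), of w] infdist_nonneg[of w K] by (intro power_mono) (auto simp: dist_norm)
  have "?m - z = (1 - t) *\<^sub>R (x - z) + t *\<^sub>R (y - z)" by (simp add: algebra_simps)
  moreover have "x - y = (x - z) - (y - z)" by simp
  moreover have "(norm ((1 - t) *\<^sub>R p + t *\<^sub>R q))\<^sup>2
      = (1 - t) * (norm p)\<^sup>2 + t * (norm q)\<^sup>2 - t * (1 - t) * (norm (p - q))\<^sup>2" for p q :: 'a
    unfolding power2_norm_eq_inner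
    by (simp add: inner_add_left inner_add_right inner_diff_left inner_diff_right inner_commute
        algebra_simps)
  ultimately have "(norm (?m - z))\<^sup>2
      = (1 - t) * (norm (x - z))\<^sup>2 + t * (norm (y - z))\<^sup>2 - t * (1 - t) * (norm (x - y))\<^sup>2"
    by metis
  moreover have "(1 - t) * (infdist x K)\<^sup>2 \<le> (1 - t) * (norm (x - z))\<^sup>2"
    "t * (infdist y K)\<^sup>2 \<le> t * (norm (y - z))\<^sup>2"
    using that le by (auto intro: mult_left_mono)
  ultimately show ?thesis using z(2) by (simp add: dist_norm)
qed

text \<open>Subtracting \<open>c s^2\<close> leaves a convex function on \<open>s \<le> M\<close>,
  where the second derivative \<open>exp (- s)\<close> is at least \<open>2 c\<close>.\<close>

lemma exp_minus_strongly_convex: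
  fixes c M :: real
  assumes "2 * c \<le> exp (- M)" "x \<le> M" "y \<le> M" "0 \<le> t" "t \<le> 1"
  shows "exp (- ((1 - t) * x + t * y)) + c * (t * (1 - t) * (x - y)\<^sup>2)
     \<le> (1 - t) * exp (- x) + t * exp (- y)"
proof -
  let ?h = "\<lambda>s. exp (- s) - c * s\<^sup>2"
  have "convex_on {..M} ?h"
  proof (rule f''_ge0_imp_convex)
    show "(?h has_real_derivative (- exp (- s) - 2 * c * s)) (at s)" for s
      by (auto intro!: derivative_eq_intros)
    show "((\<lambda>s. - exp (- s) - 2 * c * s) has_real_derivative (exp (- s) - 2 * c)) (at s)" for s
      by (auto intro!: derivative_eq_intros)
    show "0 \<le> exp (- s) - 2 * c" if "s \<in> {..M}" for s
    proof -
      have "exp (- M) \<le> exp (- s)" using that by simp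
      thus ?thesis using assms(1) by linarith
    qed
  qed simp
  from convex_onD[OF this assms(4,5), of x y]
  have "?h ((1 - t) * x + t * y) \<le> (1 - t) * ?h x + t * ?h y" using assms(2,3) by simp
  moreover have "c * ((1 - t) * x + t * y)\<^sup>2
      = (1 - t) * (c * x\<^sup>2) + t * (c * y\<^sup>2) - c * (t * (1 - t) * (x - y)\<^sup>2)"
    by (simp add: power2_eq_square algebra_simps)
  ultimately show ?thesis by (simp add: algebra_simps)
qed

text \<open>For a functional \<open>a\<close> bounded below by \<open>b\<close> on \<open>S\<close>,
  the term \<open>1 - exp (- (a x - b))\<close> is concave, below 1, and nonnegative on
  \<open>S\<close>. Finitely many spanning functionals give curvature in every direction; the
  modulus depends on \<open>R\<close> because the curvature of a term decays as \<open>a x\<close>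
  grows.\<close>

lemma bounded_strongly_concave_function:
  fixes S :: "'a::euclidean_space set"
  assumes "open S" "convex S" "S \<noteq> {}" "\<not> contains_line S"
  obtains \<phi> :: "'a \<Rightarrow> real" and B
  where "\<And>x. x \<in> closure S \<Longrightarrow> 0 \<le> \<phi> x" "\<And>x. \<phi> x \<le> B" "continuous_on UNIV \<phi>"
    "\<And>R. \<exists>c>0. \<forall>x\<in>cball 0 R. \<forall>y\<in>cball 0 R. \<forall>t. 0 \<le> t \<and> t \<le> 1 \<longrightarrow>
       (1 - t) * \<phi> x + t * \<phi> y + c * (t * (1 - t) * (norm (x - y))\<^sup>2)
         \<le> \<phi> ((1 - t) *\<^sub>R x + t *\<^sub>R y)"
proof -
  obtain A b where A: "finite A" "span A = UNIV" "\<And>a x. a \<in> A \<Longrightarrow> x \<in> S \<Longrightarrow> b a \<le> a \<bullet> x"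
    using finite_spanning_barrier[OF assms] by blast
  obtain c0 where c0: "c0 > 0" "\<And>x. c0 * (norm x)\<^sup>2 \<le> (\<Sum>a\<in>A. (a \<bullet> x)\<^sup>2)"
    using sum_squares_spanning_bound[OF A(1,2)] by blast
  define \<phi> where "\<phi> x = (\<Sum>a\<in>A. 1 - exp (- (a \<bullet> x - b a)))" for x
  show thesis
  proof
    show "0 \<le> \<phi> x" if "x \<in> closure S" for x
      unfolding \<phi>_def
    proof (rule sum_nonneg)
      fix a assume a: "a \<in> A"
      have "closure S \<subseteq> {x. b a \<le> a \<bullet> x}"
        using A(3)[OF a] by (intro closure_minimal closed_halfspace_ge) auto
      hence "b a \<le> a \<bullet> x" using that by blast
      thus "0 \<le> 1 - exp (- (a \<bullet> x - b a))" by simp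
    qed
    show "\<phi> x \<le> (\<Sum>a\<in>A. 1)" for x unfolding \<phi>_def by (rule sum_mono) simp
    show "continuous_on UNIV \<phi>" unfolding \<phi>_def by (intro continuous_intros)
    fix R :: real
    define M where "M = (\<Sum>a\<in>A. norm a * \<bar>R\<bar> + \<bar>b a\<bar>)"
    define c where "c = exp (- M) / 2"
    have M: "a \<bullet> x - b a \<le> M" if "a \<in> A" "x \<in> cball 0 R" for a x
    proof -
      have "a \<bullet> x \<le> norm a * norm x" by (rule norm_cauchy_schwarz)
      also have "\<dots> \<le> norm a * \<bar>R\<bar>" using that(2) by (intro mult_left_mono) auto
      finally have "a \<bullet> x - b a \<le> norm a * \<bar>R\<bar> + \<bar>b a\<bar>" by linarith
      also have "\<dots> \<le> M" unfolding M_def using that(1) A(1)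
        by (intro member_le_sum) auto
      finally show ?thesis .
    qed
    show "\<exists>c>0. \<forall>x\<in>cball 0 R. \<forall>y\<in>cball 0 R. \<forall>t. 0 \<le> t \<and> t \<le> 1 \<longrightarrow>
       (1 - t) * \<phi> x + t * \<phi> y + c * (t * (1 - t) * (norm (x - y))\<^sup>2)
         \<le> \<phi> ((1 - t) *\<^sub>R x + t *\<^sub>R y)"
    proof (intro exI[of _ "c * c0"] conjI ballI allI impI)
      show "0 < c * c0" using c0(1) by (simp add: c_def)
      fix x y :: 'a and t :: real assume xy: "x \<in> cball 0 R" "y \<in> cball 0 R" and t: "0 \<le> t \<and> t \<le> 1"
      have each: "(1 - t) * (1 - exp (- (a \<bullet> x - b a))) + t * (1 - exp (- (a \<bullet> y - b a)))
          + c * (t * (1 - t) * (a \<bullet> (x - y))\<^sup>2)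
          \<le> 1 - exp (- (a \<bullet> ((1 - t) *\<^sub>R x + t *\<^sub>R y) - b a))" if a: "a \<in> A" for a
      proof -
        have "exp (- ((1 - t) * (a \<bullet> x - b a) + t * (a \<bullet> y - b a)))
            + c * (t * (1 - t) * ((a \<bullet> x - b a) - (a \<bullet> y - b a))\<^sup>2)
            \<le> (1 - t) * exp (- (a \<bullet> x - b a)) + t * exp (- (a \<bullet> y - b a))"
          using M[OF a] xy t by (intro exp_minus_strongly_convex[of c M]) (auto simp: c_def)
        moreover have "(1 - t) * (a \<bullet> x - b a) + t * (a \<bullet> y - b a) = a \<bullet> ((1 - t) *\<^sub>R x + t *\<^sub>R y) - b a"
          by (simp add: inner_add_right algebra_simps)
        moreover have "(a \<bullet> x - b a) - (a \<bullet> y - b a) = a \<bullet> (x - y)" by (simp add: inner_diff_right)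
        moreover have "(1 - t) * (1 - P) + t * (1 - Q) = 1 - ((1 - t) * P + t * Q)" for P Q :: real
          by (simp add: algebra_simps)
        ultimately show ?thesis by simp
      qed
      have "(1 - t) * \<phi> x + t * \<phi> y + c * (t * (1 - t) * (\<Sum>a\<in>A. (a \<bullet> (x - y))\<^sup>2))
          = (\<Sum>a\<in>A. (1 - t) * (1 - exp (- (a \<bullet> x - b a))) + t * (1 - exp (- (a \<bullet> y - b a)))
          + c * (t * (1 - t) * (a \<bullet> (x - y))\<^sup>2))"
        unfolding \<phi>_def sum_distrib_left sum.distrib by simp
      also have "\<dots> \<le> \<phi> ((1 - t) *\<^sub>R x + t *\<^sub>R y)"
        unfolding \<phi>_def by (rule sum_mono) (rule each)
      finally have "(1 - t) * \<phi> x + t * \<phi> y + c * (t * (1 - t) * (\<Sum>a\<in>A. (a \<bullet> (x - y))\<^sup>2))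
          \<le> \<phi> ((1 - t) *\<^sub>R x + t *\<^sub>R y)" .
      moreover have "c * (t * (1 - t) * (c0 * (norm (x - y))\<^sup>2))
          \<le> c * (t * (1 - t) * (\<Sum>a\<in>A. (a \<bullet> (x - y))\<^sup>2))"
        using t c0(2)[of "x - y"] by (intro mult_left_mono) (auto simp: c_def)
      moreover have "c * (t * (1 - t) * (c0 * (norm (x - y))\<^sup>2)) = c * c0 * (t * (1 - t) * (norm (x - y))\<^sup>2)"
        by (simp add: algebra_simps)
      ultimately show "(1 - t) * \<phi> x + t * \<phi> y + c * c0 * (t * (1 - t) * (norm (x - y))\<^sup>2)
         \<le> \<phi> ((1 - t) *\<^sub>R x + t *\<^sub>R y)" by linarith
    qed
  qed
qed

text \<open>The index set of the glued minimum varies with the point. It may be replaced locally by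
  a fixed \<open>J\<close> as soon as every further index is dominated by one in
  \<open>J\<close>.\<close>

lemma segment_concave_on_Min_dominated:
  fixes c :: "'i \<Rightarrow> 'a::real_vector \<Rightarrow> real"
  assumes "finite J" "J \<noteq> {}" "\<And>j. j \<in> J \<Longrightarrow> segment_concave_on S (c j)"
    and "\<And>p. p \<in> S \<Longrightarrow> finite (D p)" "\<And>p. p \<in> S \<Longrightarrow> J \<subseteq> D p"
    and dom: "\<And>p i. p \<in> S \<Longrightarrow> i \<in> D p \<Longrightarrow> \<exists>j\<in>J. c j p \<le> c i p"
  shows "segment_concave_on S (\<lambda>p. Min ((\<lambda>i. c i p) ` D p))"
proof (rule segment_concave_on_cong)
  show "segment_concave_on S (\<lambda>p. Min ((\<lambda>j. c j p) ` J))"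
    by (rule segment_concave_on_Min[OF assms(1-3)])
  fix p assume p: "p \<in> S"
  have D: "finite (D p)" "J \<subseteq> D p" "D p \<noteq> {}" using assms(2,4,5) p by blast+
  show "Min ((\<lambda>j. c j p) ` J) = Min ((\<lambda>i. c i p) ` D p)"
  proof (rule antisym)
    have "Min ((\<lambda>j. c j p) ` J) \<le> c i p" if i: "i \<in> D p" for i
    proof -
      obtain j where "j \<in> J" "c j p \<le> c i p" using dom[OF p i] by blast
      thus ?thesis using assms(1) by (meson Min_le finite_imageI imageI order_trans)
    qed
    thus "Min ((\<lambda>j. c j p) ` J) \<le> Min ((\<lambda>i. c i p) ` D p)"
      using D by (subst Min_ge_iff) auto
    show "Min ((\<lambda>i. c i p) ` D p) \<le> Min ((\<lambda>j. c j p) ` J)"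
      using assms(2) D by (intro Min_antimono image_mono) auto
  qed
qed

section \<open>Extending a function into the hole\<close>

text \<open>Near the \<open>n\<close>-th compact piece \<open>K n\<close> of the boundary of the hole, \<open>A = g + \<epsilon> \<phi>\<close> is replaced by
  its translate \<open>A (p - s n e)\<close>, which is defined a little inside the hole, plus the term
  \<open>\<eta> n ((infdist p (K n))\<^sup>2 - (r n)\<^sup>2)\<close>. The strong concavity of \<open>\<epsilon> \<phi>\<close> absorbs the convexity of this
  term. As its sign changes at distance \<open>r n\<close>, the minimum of \<open>A\<close> and of all these functions
  switches between them before any of them stops being defined. The radii, weights and moduli
  of continuity are fixed first; the shifts \<open>s n\<close> are chosen small compared with those of the
  neighbouring pieces.\<close>

lemma extend_segment_concave:
  fixes g :: "'a::euclidean_space \<Rightarrow> real"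
  assumes dim: "2 \<le> DIM('a)" and U: "open U" "convex U" "U \<noteq> {}" "\<not> contains_line U"
    and S: "open S" "convex S" "\<not> contains_segment (frontier S)" "closure S \<subseteq> U"
    and ray: "\<And>t. 0 \<le> t \<Longrightarrow> p0 + t *\<^sub>R e \<in> S" and e: "norm e = 1"
    and g: "segment_concave_on (closure U - S) g" and "0 < \<epsilon>"
  obtains N h where "open N" "frontier S \<subseteq> N" "segment_concave_on ((closure U - S) \<union> N) h"
    "\<And>p. p \<in> frontier U \<Longrightarrow> g p \<le> h p" "\<And>p. p \<in> closure U - S \<Longrightarrow> h p \<le> g p + \<epsilon>"
proof -
  have e0: "e \<noteq> 0" using e by auto
  have rayc: "p0 + t *\<^sub>R e \<in> closure S" if "0 \<le> t" for t using ray[OF that] closure_subset by blast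
  obtain \<phi>0 :: "'a \<Rightarrow> real" and B where \<phi>0: "\<And>x. x \<in> closure U \<Longrightarrow> 0 \<le> \<phi>0 x" "\<And>x. \<phi>0 x \<le> B"
    "continuous_on UNIV \<phi>0"
    "\<And>R. \<exists>c>0. \<forall>x\<in>cball 0 R. \<forall>y\<in>cball 0 R. \<forall>t. 0 \<le> t \<and> t \<le> 1 \<longrightarrow>
       (1 - t) * \<phi>0 x + t * \<phi>0 y + c * (t * (1 - t) * (norm (x - y))\<^sup>2)
         \<le> \<phi>0 ((1 - t) *\<^sub>R x + t *\<^sub>R y)"
    using bounded_strongly_concave_function[OF U] by blast
  \<comment> \<open>This scaling turns the bound of \<open>\<phi>0\<close> into \<epsilon>; adding 1
    keeps the denominator positive.\<close>
  define \<epsilon>' where "\<epsilon>' = \<epsilon> / (\<bar>B\<bar> + 1)"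
  have \<epsilon>': "\<epsilon>' > 0" using \<open>0 < \<epsilon>\<close> by (simp add: \<epsilon>'_def add_nonneg_pos)
  define \<phi> where "\<phi> x = \<epsilon>' * \<phi>0 x" for x
  have \<phi>: "0 \<le> \<phi> x" if "x \<in> closure U" for x using \<phi>0(1)[OF that] \<epsilon>' by (simp add: \<phi>_def)
  have \<phi>le: "\<phi> x \<le> \<epsilon>" for x
  proof -
    have "\<phi> x \<le> \<epsilon>' * (\<bar>B\<bar> + 1)"
      unfolding \<phi>_def using \<phi>0(2)[of x] \<epsilon>' by (intro mult_left_mono) auto
    also have "\<dots> = \<epsilon>" by (simp add: \<epsilon>'_def)
    finally show ?thesis .
  qed
  \<comment> \<open>Points of the \<open>n\<close>-th boundary piece have norm at most
    \<open>n + 1\<close>; the radius \<open>n + 3\<close> leaves room for a neighbourhood and a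
    shift. The modulus of strong concavity becomes the weight \<open>\<eta> n\<close> of the
    correction.\<close>
  have "\<forall>n::nat. \<exists>c>0. \<forall>x\<in>cball 0 (real n + 3). \<forall>y\<in>cball 0 (real n + 3). \<forall>t. 0 \<le> t \<and> t \<le> 1 \<longrightarrow>
       (1 - t) * \<phi> x + t * \<phi> y + c * (t * (1 - t) * (norm (x - y))\<^sup>2)
         \<le> \<phi> ((1 - t) *\<^sub>R x + t *\<^sub>R y)"
  proof
    fix n :: nat
    obtain c where c: "c > 0" "\<forall>x\<in>cball 0 (real n + 3). \<forall>y\<in>cball 0 (real n + 3). \<forall>t. 0 \<le> t \<and> t \<le> 1 \<longrightarrow>
       (1 - t) * \<phi>0 x + t * \<phi>0 y + c * (t * (1 - t) * (norm (x - y))\<^sup>2)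
         \<le> \<phi>0 ((1 - t) *\<^sub>R x + t *\<^sub>R y)"
      using \<phi>0(4) by blast
    show "\<exists>c>0. \<forall>x\<in>cball 0 (real n + 3). \<forall>y\<in>cball 0 (real n + 3). \<forall>t. 0 \<le> t \<and> t \<le> 1 \<longrightarrow>
       (1 - t) * \<phi> x + t * \<phi> y + c * (t * (1 - t) * (norm (x - y))\<^sup>2)
         \<le> \<phi> ((1 - t) *\<^sub>R x + t *\<^sub>R y)"
    proof (intro exI[of _ "\<epsilon>' * c"] conjI ballI allI impI)
      fix x y :: 'a and t :: real
      assume "x \<in> cball 0 (real n + 3)" "y \<in> cball 0 (real n + 3)" "0 \<le> t \<and> t \<le> 1"
      hence "\<epsilon>' * ((1 - t) * \<phi>0 x + t * \<phi>0 y + c * (t * (1 - t) * (norm (x - y))\<^sup>2))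
         \<le> \<epsilon>' * \<phi>0 ((1 - t) *\<^sub>R x + t *\<^sub>R y)"
        using c(2) \<epsilon>' by (intro mult_left_mono) auto
      thus "(1 - t) * \<phi> x + t * \<phi> y + \<epsilon>' * c * (t * (1 - t) * (norm (x - y))\<^sup>2)
         \<le> \<phi> ((1 - t) *\<^sub>R x + t *\<^sub>R y)" by (simp add: \<phi>_def algebra_simps)
    qed (use c(1) \<epsilon>' in simp)
  qed
  from choice[OF this] obtain \<eta> where \<eta>: "\<And>n::nat. 0 < \<eta> n"
    "\<And>n x y t. x \<in> cball 0 (real n + 3) \<Longrightarrow> y \<in> cball 0 (real n + 3) \<Longrightarrow> 0 \<le> t \<Longrightarrow> t \<le> 1 \<Longrightarrow>
       (1 - t) * \<phi> x + t * \<phi> y + \<eta> n * (t * (1 - t) * (norm (x - y))\<^sup>2)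
         \<le> \<phi> ((1 - t) *\<^sub>R x + t *\<^sub>R y)"
    by blast
  define A where "A p = g p + \<phi> p" for p
  have \<phi>conc: "(1 - t) * \<phi> x + t * \<phi> y \<le> \<phi> ((1 - t) *\<^sub>R x + t *\<^sub>R y)" if t: "0 \<le> t" "t \<le> 1" for x y t
  proof -
    define n where "n = nat \<lceil>max (norm x) (norm y)\<rceil>"
    have "norm x \<le> real n + 3" "norm y \<le> real n + 3" unfolding n_def by linarith+
    hence "(1 - t) * \<phi> x + t * \<phi> y + \<eta> n * (t * (1 - t) * (norm (x - y))\<^sup>2)
        \<le> \<phi> ((1 - t) *\<^sub>R x + t *\<^sub>R y)"
      using t by (intro \<eta>(2)) auto
    moreover have "0 \<le> \<eta> n * (t * (1 - t) * (norm (x - y))\<^sup>2)"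
      using t \<eta>(1)[of n] by (intro mult_nonneg_nonneg) auto
    ultimately show ?thesis by linarith
  qed
  have A: "segment_concave_on (closure U - S) A"
    unfolding segment_concave_on_def
  proof (intro allI impI concave_onI)
    fix a b x y and t :: real
    assume ab: "closed_segment a b \<subseteq> closure U - S"
      and *: "x \<in> closed_segment a b" "y \<in> closed_segment a b" "0 \<le> t" "t \<le> 1"
    have "closed_segment x y \<subseteq> closure U - S" using ab * subset_closed_segment by blast
    from segment_concave_onD[OF g this *(3,4)] \<phi>conc[OF *(3,4), of x y]
    show "(1 - t) * A x + t * A y \<le> A ((1 - t) *\<^sub>R x + t *\<^sub>R y)"
      by (simp add: A_def algebra_simps)
  qed simp
  have UO: "U - S \<subseteq> closure U - S" using closure_subset by blast
  have contA: "continuous_on (U - S) A"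
    by (rule segment_concave_on_continuous[OF dim S(1-3) U(1) segment_concave_on_subset[OF A UO]])
  define K where "K n = frontier S \<inter> {p. real n \<le> norm p \<and> norm p \<le> real n + 1}" for n
  have K: "compact (K n)" "closed (K n)" "K n \<subseteq> U" for n
  proof -
    have "K n = frontier S \<inter> (cball 0 (real n + 1) \<inter> - ball 0 (real n))"
      by (auto simp: K_def)
    thus "compact (K n)" by (simp add: compact_Int closed_Int_compact compact_diff flip: Diff_eq)
    thus "closed (K n)" by (rule compact_imp_closed)
    show "K n \<subseteq> U" using S(4) by (auto simp: K_def frontier_def)
  qed
  have att: "\<exists>z\<in>K n. infdist p (K n) = dist p z" if "K n \<noteq> {}" for p n
    using infdist_attains_inf[OF K(2) that] by blast
  \<comment> \<open>The guard \<open>K n \<noteq> {}\<close> matters because \<open>infdist\<close>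
    to the empty set is 0. The bound 1/8 ensures that the neighbourhoods used around two pieces meet
    only if their indices differ by at most one.\<close>
  have "\<forall>n. \<exists>r>0. r \<le> 1/8 \<and> (\<forall>p. K n \<noteq> {} \<and> infdist p (K n) \<le> 3 * r \<longrightarrow> p \<in> U)"
  proof
    fix n
    obtain d where d: "d > 0" "(\<Union>x\<in>K n. ball x d) \<subseteq> U"
      using compact_subset_open_imp_ball_epsilon_subset[OF K(1) U(1) K(3)] by blast
    have "p \<in> U" if p: "K n \<noteq> {}" "infdist p (K n) \<le> 3 * min (1/8) (d/4)" for p
    proof -
      obtain z where z: "z \<in> K n" "infdist p (K n) = dist p z" using att[OF p(1)] by blast
      have "p \<in> ball z d" using z(2) p(2) d(1) by (simp add: dist_commute)
      thus ?thesis using d(2) z(1) by blast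
    qed
    thus "\<exists>r>0. r \<le> 1/8 \<and> (\<forall>p. K n \<noteq> {} \<and> infdist p (K n) \<le> 3 * r \<longrightarrow> p \<in> U)"
      using d(1) by (intro exI[of _ "min (1/8) (d/4)"]) auto
  qed
  from choice[OF this] obtain r where r: "\<And>n. 0 < r n" "\<And>n. r n \<le> 1/8"
    "\<And>n p. K n \<noteq> {} \<Longrightarrow> infdist p (K n) \<le> 3 * r n \<Longrightarrow> p \<in> U" by blast
  have near: "real n - 3 * r n \<le> norm p \<and> norm p \<le> real n + 1 + infdist p (K n)"
    if p: "K n \<noteq> {}" "infdist p (K n) \<le> 3 * r n" for p n
  proof -
    obtain z where z: "z \<in> K n" "infdist p (K n) = dist p z" using att[OF p(1)] by blast
    have "norm p \<le> norm z + dist p z" "norm z \<le> norm p + dist p z"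
      using norm_triangle_sub[of p z] norm_triangle_sub[of z p]
      by (simp_all add: dist_norm norm_minus_commute)
    thus ?thesis using z p(2) by (auto simp: K_def)
  qed
  \<comment> \<open>The radius \<open>3 r n\<close> is the range \<open>2 r n\<close> in which the
    translate \<open>G n\<close> competes, enlarged by the largest possible shift.\<close>
  define C where "C n = {p. K n \<noteq> {} \<and> infdist p (K n) \<le> 3 * r n} - S" for n
  have C: "compact (C n)" "C n \<subseteq> U - S" for n
  proof -
    have "closed {p. infdist p (K n) \<le> 3 * r n}"
      by (intro closed_Collect_le continuous_intros)
    hence "closed (C n)"
      unfolding C_def using S(1) by (cases "K n = {}") auto
    moreover have "C n \<subseteq> cball 0 (real n + 2)"
    proof
      fix p assume "p \<in> C n"
      thus "p \<in> cball 0 (real n + 2)" using near[of n p] r(2)[of n] by (auto simp: C_def)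
    qed
    ultimately show "compact (C n)"
      by (metis bounded_cball bounded_subset compact_eq_bounded_closed)
    show "C n \<subseteq> U - S" using r(3) by (auto simp: C_def)
  qed
  have "\<forall>n. \<exists>d>0. \<forall>u\<in>C n. \<forall>v\<in>C n. dist u v < d \<longrightarrow> \<bar>A u - A v\<bar> < \<eta> n * (r n)\<^sup>2 / 2"
  proof
    fix n
    have "uniformly_continuous_on (C n) A"
      by (intro compact_uniformly_continuous continuous_on_subset[OF contA] C)
    moreover have "\<eta> n * (r n)\<^sup>2 / 2 > 0" using \<eta>(1)[of n] r(1)[of n] by simp
    ultimately show "\<exists>d>0. \<forall>u\<in>C n. \<forall>v\<in>C n. dist u v < d \<longrightarrow> \<bar>A u - A v\<bar> < \<eta> n * (r n)\<^sup>2 / 2"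
      unfolding uniformly_continuous_on_def by (metis dist_real_def dist_commute)
  qed
  from choice[OF this] obtain m where m: "\<And>n. 0 < m n"
    "\<And>n u v. u \<in> C n \<Longrightarrow> v \<in> C n \<Longrightarrow> dist u v < m n \<Longrightarrow> \<bar>A u - A v\<bar> < \<eta> n * (r n)\<^sup>2 / 2" by blast
  \<comment> \<open>The values of \<open>A\<close> shifted by \<open>s n\<close> are also compared
    at points near a neighbouring piece, hence the three indices; for \<open>n = 0\<close> the
    truncated \<open>n - 1\<close> merely repeats 0. Halving \<open>m k\<close> gives the strict
    inequality needed for uniform continuity.\<close>
  define s where "s n = Min ((\<lambda>k. min (r k) (m k / 2)) ` {n - 1, n, Suc n})" for n
  have spos: "0 < s n" for n unfolding s_def using r(1) m(1) by simp
  have sle: "s n \<le> r k" "s n < m k" if "n \<le> Suc k" "k \<le> Suc n" for n k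
  proof -
    have "k \<in> {n - 1, n, Suc n}" using that by auto
    hence "s n \<le> min (r k) (m k / 2)" unfolding s_def by (intro Min_le) auto
    thus "s n \<le> r k" "s n < m k" using m(1)[of k] by auto
  qed
  have overlap: "n \<le> Suc k" if "K n \<noteq> {}" "infdist p (K n) \<le> 2 * r n" "K k \<noteq> {}" "infdist p (K k) \<le> 2 * r k" for n k p
    using near[OF that(1), of p] near[OF that(3), of p] that r(1,2)[of n] r(1,2)[of k] by linarith
  have inC: "p - s n *\<^sub>R e \<in> C k"
    if "K k \<noteq> {}" "infdist p (K k) \<le> 2 * r k" "n \<le> Suc k" "k \<le> Suc n" "p - s n *\<^sub>R e \<notin> S" for p n k
  proof -
    have "infdist (p - s n *\<^sub>R e) (K k) \<le> infdist p (K k) + dist (p - s n *\<^sub>R e) p"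
      by (rule infdist_triangle)
    also have "dist (p - s n *\<^sub>R e) p = s n" using e spos[of n] by (simp add: dist_norm)
    finally show ?thesis using sle(1)[OF that(3,4)] that by (simp add: C_def)
  qed
  define G where "G n p = A (p - s n *\<^sub>R e) + \<eta> n * ((infdist p (K n))\<^sup>2 - (r n)\<^sup>2)" for n p
  \<comment> \<open>Removed are the points at which some \<open>G k\<close> would compete while
    reading \<open>A\<close> in the closed hole. On \<open>N\<close> every competing translate is
    therefore defined.\<close>
  define N where "N = {p. \<exists>n. K n \<noteq> {} \<and> infdist p (K n) < r n / 2} -
      (\<Union>k\<in>{k. K k \<noteq> {}}. {p. infdist p (K k) \<le> 2 * r k \<and> p - s k *\<^sub>R e \<in> closure S})"
  have below: "p - s k *\<^sub>R e \<notin> closure S" if "p \<notin> S" for p k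
  proof
    assume "p - s k *\<^sub>R e \<in> closure S"
    from recession_strictly_convex[OF S(1-3) rayc e0 this spos[of k]]
    show False using that by simp
  qed
  \<comment> \<open>Measured in units of \<open>\<eta> k * (r k)^2\<close>, the correction is at
    least 5/4 beyond distance \<open>3/2 r k\<close> and at most -3/4 within \<open>r k / 2\<close>.
    Both outweigh the oscillation 1/2 allowed to \<open>A\<close> by the choice of
    \<open>m k\<close>, so the sign of the correction decides every comparison.\<close>
  have far: "5/4 * (\<eta> k * (r k)\<^sup>2) \<le> \<eta> k * ((infdist p (K k))\<^sup>2 - (r k)\<^sup>2)"
    if "3/2 * r k < infdist p (K k)" for p k
  proof -
    have "(3/2 * r k)\<^sup>2 \<le> (infdist p (K k))\<^sup>2"
      using that r(1)[of k] by (intro power_mono) auto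
    hence "5/4 * (r k)\<^sup>2 \<le> (infdist p (K k))\<^sup>2 - (r k)\<^sup>2"
      by (simp add: power_mult_distrib power2_eq_square)
    from mult_left_mono[OF this, of "\<eta> k"] show ?thesis using \<eta>(1)[of k] by simp
  qed
  have close: "\<eta> k * ((infdist p (K k))\<^sup>2 - (r k)\<^sup>2) \<le> - (3/4) * (\<eta> k * (r k)\<^sup>2)"
    if "infdist p (K k) < r k / 2" for p k
  proof -
    have "(infdist p (K k))\<^sup>2 \<le> (r k / 2)\<^sup>2"
      using that infdist_nonneg[of p "K k"] by (intro power_mono) auto
    hence "(infdist p (K k))\<^sup>2 - (r k)\<^sup>2 \<le> - (3/4) * (r k)\<^sup>2"
      by (simp add: power_divide)
    from mult_left_mono[OF this, of "\<eta> k"] show ?thesis using \<eta>(1)[of k] by simp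
  qed
  have \<eta>r: "0 < \<eta> k * (r k)\<^sup>2" for k using \<eta>(1)[of k] r(1)[of k] by simp
  have A_le_G: "A p \<le> G k p"
    if "K k \<noteq> {}" "infdist p (K k) \<le> 2 * r k" "3/2 * r k < infdist p (K k)" "p \<notin> S" for p k
  proof -
    have "p - s k *\<^sub>R e \<in> C k" using that below[OF that(4), of k] closure_subset by (intro inC) auto
    moreover have "p \<in> C k" using that r(1)[of k] by (simp add: C_def)
    moreover have "dist p (p - s k *\<^sub>R e) < m k"
      using sle(2)[of k k] e spos[of k] by (simp add: dist_norm)
    ultimately have "\<bar>A p - A (p - s k *\<^sub>R e)\<bar> < \<eta> k * (r k)\<^sup>2 / 2" by (intro m(2))
    thus ?thesis using far[OF that(3)] \<eta>r[of k] unfolding G_def by argo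
  qed
  have G_le_G: "G n p \<le> G k p"
    if k: "K k \<noteq> {}" "infdist p (K k) \<le> 2 * r k" "3/2 * r k < infdist p (K k)" "p - s k *\<^sub>R e \<notin> S"
      and n: "K n \<noteq> {}" "infdist p (K n) < r n / 2" "p - s n *\<^sub>R e \<notin> S" for p k n
  proof -
    have n2: "infdist p (K n) \<le> 2 * r n" using n(2) r(1)[of n] by linarith
    have nk: "n \<le> Suc k" "k \<le> Suc n" using overlap[OF n(1) n2 k(1,2)] overlap[OF k(1,2) n(1) n2] .
    have "p - s n *\<^sub>R e \<in> C k" "p - s k *\<^sub>R e \<in> C k" using k n nk by (auto intro!: inC)
    moreover have "dist (p - s n *\<^sub>R e) (p - s k *\<^sub>R e) < m k"
    proof -
      have "dist (p - s n *\<^sub>R e) (p - s k *\<^sub>R e) = norm ((s k - s n) *\<^sub>R e)"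
        by (simp add: dist_norm algebra_simps)
      also have "\<dots> = \<bar>s k - s n\<bar>" using e by simp
      also have "\<dots> < m k" using sle(2)[OF nk] sle(2)[of k k] spos[of n] spos[of k] by auto
      finally show ?thesis .
    qed
    ultimately have "\<bar>A (p - s n *\<^sub>R e) - A (p - s k *\<^sub>R e)\<bar> < \<eta> k * (r k)\<^sup>2 / 2" by (intro m(2))
    thus ?thesis using far[OF k(3)] close[OF n(2)] \<eta>r[of k] \<eta>r[of n] unfolding G_def by argo
  qed
  have G_le_A: "G n p \<le> A p" if "K n \<noteq> {}" "infdist p (K n) < r n / 2" "p \<notin> S" for p n
  proof -
    have n2: "infdist p (K n) \<le> 2 * r n" using that(2) r(1)[of n] by linarith
    have "p - s n *\<^sub>R e \<in> C n" using that n2 below[OF that(3), of n] closure_subset by (intro inC) auto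
    moreover have "p \<in> C n" using that n2 r(1)[of n] by (simp add: C_def)
    moreover have "dist p (p - s n *\<^sub>R e) < m n"
      using sle(2)[of n n] e spos[of n] by (simp add: dist_norm)
    ultimately have "\<bar>A p - A (p - s n *\<^sub>R e)\<bar> < \<eta> n * (r n)\<^sup>2 / 2" by (intro m(2))
    thus ?thesis using close[OF that(2)] \<eta>r[of n] unfolding G_def by argo
  qed
  have frN: "frontier S \<subseteq> N"
  proof
    fix z assume z: "z \<in> frontier S"
    hence zS: "z \<notin> S" using S(1) by (simp add: frontier_def interior_open)
    define n where "n = nat \<lfloor>norm z\<rfloor>"
    have "real n \<le> norm z" "norm z \<le> real n + 1" using norm_ge_zero[of z] unfolding n_def by linarith+
    hence "z \<in> K n" using z by (simp add: K_def)
    hence "K n \<noteq> {} \<and> infdist z (K n) < r n / 2" using r(1)[of n] by auto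
    thus "z \<in> N" unfolding N_def using below[OF zS] by blast
  qed
  have index_bound: "real k \<le> norm p + 1" if "K k \<noteq> {}" "infdist p (K k) \<le> 3 * r k" for p k
    using near[OF that] r(2)[of k] by linarith
  have openN: "open N"
    unfolding open_contains_ball
  proof
    fix p assume p: "p \<in> N"
    let ?Q = "\<lambda>k. {p. infdist p (K k) \<le> 2 * r k \<and> p - s k *\<^sub>R e \<in> closure S}"
    \<comment> \<open>Local finiteness is what makes \<open>N\<close> open: on a unit ball around
      \<open>p\<close> only these finitely many closed sets are removed.\<close>
    define F where "F = {k. K k \<noteq> {}} \<inter> {..nat \<lceil>norm p\<rceil> + 2}"
    define W where "W = (\<Union>n\<in>{n. K n \<noteq> {}}. {p. infdist p (K n) < r n / 2}) \<inter> - (\<Union>k\<in>F. ?Q k) \<inter> ball p 1"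
    have "closed (?Q k)" for k
    proof -
      have "closed {p. infdist p (K k) \<le> 2 * r k}" by (intro closed_Collect_le continuous_intros)
      moreover have "closed ((\<lambda>p. p - s k *\<^sub>R e) -` closure S)"
        by (intro closed_vimage continuous_intros) simp
      moreover have "?Q k = {p. infdist p (K k) \<le> 2 * r k} \<inter> (\<lambda>p. p - s k *\<^sub>R e) -` closure S" by auto
      ultimately show ?thesis by (simp add: closed_Int)
    qed
    hence "closed (\<Union>k\<in>F. ?Q k)" by (intro closed_UN) (auto simp: F_def)
    moreover have "open (\<Union>n\<in>{n. K n \<noteq> {}}. {p. infdist p (K n) < r n / 2})"
      by (intro open_UN ballI open_Collect_less continuous_intros)
    ultimately have "open W" unfolding W_def by (intro open_Int open_Compl open_ball)
    moreover have "p \<in> ball p 1" by simp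
    hence "p \<in> W" using p unfolding W_def N_def F_def by blast
    ultimately obtain d where d: "d > 0" "ball p d \<subseteq> W" using open_contains_ball by blast
    have "W \<subseteq> N"
    proof
      fix q assume q: "q \<in> W"
      have "q \<notin> ?Q k" if k: "K k \<noteq> {}" for k
      proof
        assume qk: "q \<in> ?Q k"
        have "real k \<le> norm q + 1" using qk k r(1)[of k] by (intro index_bound) auto
        moreover have "norm q \<le> norm p + 1"
          using q norm_triangle_sub[of q p] by (auto simp: W_def dist_norm norm_minus_commute)
        ultimately have "k \<in> F" unfolding F_def using k by simp linarith
        thus False using q qk unfolding W_def by blast
      qed
      thus "q \<in> N" using q unfolding W_def N_def by blast
    qed
    thus "\<exists>d>0. ball p d \<subseteq> N" using d by blast
  qed
  have NU: "N \<subseteq> U"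
  proof
    fix p assume "p \<in> N"
    then obtain n where n: "K n \<noteq> {}" "infdist p (K n) < r n / 2" unfolding N_def by blast
    show "p \<in> U" using n r(1)[of n] by (intro r(3)[OF n(1)]) linarith
  qed
  \<comment> \<open>\<open>None\<close> stands for \<open>A\<close> itself, available off the hole
    only. \<open>Some k\<close> stands for \<open>G k\<close>, available near \<open>K k\<close>
    where it does not read values inside the hole.\<close>
  define D :: "'a \<Rightarrow> nat option set" where
    "D p = {i. i = None \<and> p \<notin> S} \<union> Some ` {k. K k \<noteq> {} \<and> infdist p (K k) < 2 * r k \<and> p - s k *\<^sub>R e \<notin> S}" for p
  define c :: "nat option \<Rightarrow> 'a \<Rightarrow> real" where "c i = (case i of None \<Rightarrow> A | Some k \<Rightarrow> G k)" for i
  define h where "h p = Min ((\<lambda>i. c i p) ` D p)" for p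
  have fin: "finite {k. K k \<noteq> {} \<and> infdist p (K k) < 2 * r k}" for p
  proof (rule finite_subset)
    show "{k. K k \<noteq> {} \<and> infdist p (K k) < 2 * r k} \<subseteq> {..nat \<lceil>norm p\<rceil> + 1}"
    proof
      fix k assume "k \<in> {k. K k \<noteq> {} \<and> infdist p (K k) < 2 * r k}"
      hence "real k \<le> norm p + 1" using r(1)[of k] by (intro index_bound) auto
      thus "k \<in> {..nat \<lceil>norm p\<rceil> + 1}" by simp linarith
    qed
  qed simp
  have finD: "finite (D p)" for p
    unfolding D_def by (intro finite_UnI finite_imageI finite_subset[OF _ fin[of p]]) auto
  have G_concave: "segment_concave_on (ball p d) (G k)"
    if b: "\<And>q. q \<in> ball p d \<Longrightarrow> infdist q (K k) < 2 * r k \<and> q - s k *\<^sub>R e \<in> U - closure S"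
      and Kk: "K k \<noteq> {}" for p d k
    unfolding segment_concave_on_iff_concave_on[OF convex_ball]
  proof (rule concave_onI[OF convex_ball])
    fix x y and t :: real assume xy: "x \<in> ball p d" "y \<in> ball p d" and t: "0 \<le> t" "t \<le> 1"
    let ?x = "x - s k *\<^sub>R e" and ?y = "y - s k *\<^sub>R e" and ?z = "(1 - t) *\<^sub>R x + t *\<^sub>R y"
    have z: "?z - s k *\<^sub>R e = (1 - t) *\<^sub>R ?x + t *\<^sub>R ?y" by (simp add: algebra_simps)
    have "closed_segment ?x ?y \<subseteq> closure U - S"
    proof
      fix w assume "w \<in> closed_segment ?x ?y"
      then obtain u where u: "0 \<le> u" "u \<le> 1" "w = (1 - u) *\<^sub>R ?x + u *\<^sub>R ?y" by (auto simp: in_segment)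
      have "(1 - u) *\<^sub>R x + u *\<^sub>R y \<in> ball p d" using xy u by (intro convexD_alt convex_ball)
      moreover have "w = (1 - u) *\<^sub>R x + u *\<^sub>R y - s k *\<^sub>R e" by (simp add: u(3) algebra_simps)
      ultimately have "w \<in> U - closure S" using b by blast
      thus "w \<in> closure U - S" using closure_subset by blast
    qed
    from segment_concave_onD[OF g this t]
    have 1: "(1 - t) * g ?x + t * g ?y \<le> g (?z - s k *\<^sub>R e)" by (simp add: z)
    have cb: "q - s k *\<^sub>R e \<in> cball 0 (real k + 3)" if q: "q \<in> ball p d" for q
    proof -
      have q2: "infdist q (K k) < 2 * r k" using b[OF q] by blast
      hence "norm q \<le> real k + 1 + infdist q (K k)"
        using near[OF Kk, of q] r(1)[of k] by auto
      moreover have "norm (q - s k *\<^sub>R e) \<le> norm q + s k"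
        using norm_triangle_ineq4[of q "s k *\<^sub>R e"] e spos[of k] by simp
      ultimately show ?thesis using q2 r(2)[of k] sle(1)[of k k] by simp
    qed
    have 2: "(1 - t) * \<phi> ?x + t * \<phi> ?y + \<eta> k * (t * (1 - t) * (norm (x - y))\<^sup>2) \<le> \<phi> (?z - s k *\<^sub>R e)"
      using \<eta>(2)[OF cb[OF xy(1)] cb[OF xy(2)] t] by (simp add: z)
    have "(1 - t) * (infdist x (K k))\<^sup>2 + t * (infdist y (K k))\<^sup>2 - t * (1 - t) * (norm (x - y))\<^sup>2
        \<le> (infdist ?z (K k))\<^sup>2"
      by (rule infdist_square_semiconcave[OF K(2) Kk t])
    hence 3: "\<eta> k * ((1 - t) * (infdist x (K k))\<^sup>2 + t * (infdist y (K k))\<^sup>2 - t * (1 - t) * (norm (x - y))\<^sup>2)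
        \<le> \<eta> k * (infdist ?z (K k))\<^sup>2"
      using \<eta>(1)[of k] by (intro mult_left_mono) auto
    \<comment> \<open>The surplus from strong concavity of \<open>\<phi>\<close> and the convexity
      defect of the squared distance carry the same weight \<open>\<eta> k\<close> and
      cancel.\<close>
    have "(1 - t) * G k x + t * G k y = ((1 - t) * g ?x + t * g ?y)
        + ((1 - t) * \<phi> ?x + t * \<phi> ?y + \<eta> k * (t * (1 - t) * (norm (x - y))\<^sup>2))
        + \<eta> k * ((1 - t) * (infdist x (K k))\<^sup>2 + t * (infdist y (K k))\<^sup>2 - t * (1 - t) * (norm (x - y))\<^sup>2)
        - \<eta> k * (r k)\<^sup>2"
      by (simp add: G_def A_def algebra_simps)
    also have "\<dots> \<le> g (?z - s k *\<^sub>R e) + \<phi> (?z - s k *\<^sub>R e) + \<eta> k * (infdist ?z (K k))\<^sup>2 - \<eta> k * (r k)\<^sup>2"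
      using 1 2 3 by linarith
    also have "\<dots> = G k ?z" by (simp add: G_def A_def algebra_simps)
    finally show "(1 - t) * G k x + t * G k y \<le> G k ?z" .
  qed
  show thesis
  proof
    show "open N" "frontier S \<subseteq> N" by (rule openN, rule frN)
    show "h p \<le> g p + \<epsilon>" if p: "p \<in> closure U - S" for p
    proof -
      have "None \<in> D p" using p by (simp add: D_def)
      hence "h p \<le> c None p" unfolding h_def using finD by (intro Min_le) auto
      thus ?thesis using \<phi>le[of p] by (simp add: c_def A_def)
    qed
    show "g p \<le> h p" if p: "p \<in> frontier U" for p
    proof -
      have pU: "p \<notin> U" "p \<in> closure U" using p U(1) by (auto simp: frontier_def interior_open)
      have "p \<notin> S" using pU(1) S(4) closure_subset by blast
      \<comment> \<open>On the outer frontier no translate competes, since the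
        \<open>3 r k\<close>-neighbourhood of \<open>K k\<close> lies in \<open>U\<close>.\<close>
      moreover have "\<not> infdist p (K k) < 2 * r k" if "K k \<noteq> {}" for k
        using r(3)[OF that, of p] r(1)[of k] pU(1) by (intro notI) auto
      ultimately have "D p = {None}" unfolding D_def by auto
      hence "h p = A p" by (simp add: h_def c_def)
      thus ?thesis using \<phi>[OF pU(2)] by (simp add: A_def)
    qed
    show "segment_concave_on ((closure U - S) \<union> N) h"
    proof (rule segment_concave_on_local)
      let ?T = "(closure U - S) \<union> N"
      fix p0 assume p0: "p0 \<in> ?T"
      \<comment> \<open>Translates competing at \<open>p0\<close> remain available nearby. Any other
        translate can enter the minimum near \<open>p0\<close> only farther than
        \<open>3/2 r k\<close> from its piece, where it is dominated.\<close>
      define J0 where "J0 = {k. K k \<noteq> {} \<and> infdist p0 (K k) < 2 * r k}"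
      have J0: "finite J0" unfolding J0_def by (rule fin)
      have shift: "p0 - s k *\<^sub>R e \<in> U - closure S" if k: "k \<in> J0" for k
      proof -
        have k': "K k \<noteq> {}" "infdist p0 (K k) < 2 * r k" using k by (auto simp: J0_def)
        have ncl: "p0 - s k *\<^sub>R e \<notin> closure S"
        proof (cases "p0 \<in> S")
          case True
          hence "p0 \<in> N" using p0 by blast
          thus ?thesis using k'(1) less_imp_le[OF k'(2)] unfolding N_def by blast
        qed (rule below)
        hence "p0 - s k *\<^sub>R e \<in> C k" using k' closure_subset by (intro inC) auto
        thus ?thesis using ncl C(2) by blast
      qed
      have inside: "\<forall>\<^sub>F p in nhds p0. infdist p (K k) < 2 * r k \<and> p - s k *\<^sub>R e \<in> U - closure S"
        if k: "k \<in> J0" for k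
      proof -
        have "open ({p. infdist p (K k) < 2 * r k} \<inter> (\<lambda>p. p - s k *\<^sub>R e) -` (U - closure S))"
          using U(1) by (intro open_Int open_Collect_less open_vimage open_Diff continuous_intros) auto
        moreover have "p0 \<in> {p. infdist p (K k) < 2 * r k} \<inter> (\<lambda>p. p - s k *\<^sub>R e) -` (U - closure S)"
          using shift[OF k] k by (simp add: J0_def)
        ultimately show ?thesis by (rule eventually_nhds_in_open[THEN eventually_mono]) auto
      qed
      define F where "F = {k. K k \<noteq> {}} \<inter> {..nat \<lceil>norm p0\<rceil> + 2} - J0"
      have outside: "\<forall>\<^sub>F p in nhds p0. 3/2 * r k < infdist p (K k)" if k: "k \<in> F" for k
      proof -
        have "open {p. 3/2 * r k < infdist p (K k)}" by (intro open_Collect_less continuous_intros)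
        moreover have "p0 \<in> {p. 3/2 * r k < infdist p (K k)}"
          using k r(1)[of k] by (auto simp: F_def J0_def)
        ultimately show ?thesis by (rule eventually_nhds_in_open[THEN eventually_mono]) auto
      qed
      have "\<forall>\<^sub>F p in nhds p0. \<forall>k\<in>J0. infdist p (K k) < 2 * r k \<and> p - s k *\<^sub>R e \<in> U - closure S"
        using J0 inside by (intro eventually_ball_finite) auto
      moreover have "\<forall>\<^sub>F p in nhds p0. \<forall>k\<in>F. 3/2 * r k < infdist p (K k)"
        using outside by (intro eventually_ball_finite) (auto simp: F_def)
      moreover have "\<forall>\<^sub>F p in nhds p0. p \<in> ball p0 1"
        by (intro eventually_nhds_in_open) auto
      ultimately have common: "\<forall>\<^sub>F p in nhds p0.
          (\<forall>k\<in>J0. infdist p (K k) < 2 * r k \<and> p - s k *\<^sub>R e \<in> U - closure S) \<and>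
          (\<forall>k. K k \<noteq> {} \<and> k \<notin> J0 \<and> infdist p (K k) < 2 * r k \<longrightarrow> 3/2 * r k < infdist p (K k))"
      proof eventually_elim
        case (elim p)
        have "3/2 * r k < infdist p (K k)" if k: "K k \<noteq> {}" "k \<notin> J0" "infdist p (K k) < 2 * r k" for k
        proof -
          have "real k \<le> norm p + 1" using k r(1)[of k] by (intro index_bound) auto
          moreover have "norm p \<le> norm p0 + 1"
            using elim(3) norm_triangle_sub[of p p0] by (simp add: dist_norm norm_minus_commute)
          ultimately have "k \<in> F" using k by (simp add: F_def) linarith
          thus ?thesis using elim(2) by blast
        qed
        thus ?case using elim(1) by blast
      qed
      define J where "J = Some ` J0 \<union> (if p0 \<in> N then {} else {None})"
      have finJ: "finite J" using J0 by (simp add: J_def)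
      have switch: "\<forall>\<^sub>F p in nhds p0. (p0 \<notin> N \<longrightarrow> p \<notin> S) \<and>
          (p0 \<in> N \<longrightarrow> (\<exists>n\<in>J0. infdist p (K n) < r n / 2))"
      proof (cases "p0 \<in> N")
        case True
        then obtain n where n: "K n \<noteq> {}" "infdist p0 (K n) < r n / 2" unfolding N_def by blast
        have "open {p. infdist p (K n) < r n / 2}" by (intro open_Collect_less continuous_intros)
        moreover have "p0 \<in> {p. infdist p (K n) < r n / 2}" using n(2) by simp
        ultimately have "\<forall>\<^sub>F p in nhds p0. p \<in> {p. infdist p (K n) < r n / 2}"
          by (rule eventually_nhds_in_open)
        moreover have "n \<in> J0" using n r(1)[of n] by (simp add: J0_def)
        ultimately show ?thesis using True by (auto elim!: eventually_mono)
      next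
        case False
        hence "p0 \<notin> S" "p0 \<notin> frontier S" using p0 frN by blast+
        hence "p0 \<in> - closure S" using S(1) by (simp add: frontier_def interior_open)
        hence "\<forall>\<^sub>F p in nhds p0. p \<in> - closure S" by (intro eventually_nhds_in_open) auto
        thus ?thesis using False closure_subset[of S] by (auto elim!: eventually_mono)
      qed
      have neJ: "J \<noteq> {}"
        using eventually_nhds_x_imp_x[OF switch] by (auto simp: J_def)
      obtain d where d: "d > 0" "\<And>p k. p \<in> ball p0 d \<Longrightarrow> k \<in> J0 \<Longrightarrow> infdist p (K k) < 2 * r k \<and> p - s k *\<^sub>R e \<in> U - closure S"
        "\<And>p k. p \<in> ball p0 d \<Longrightarrow> K k \<noteq> {} \<Longrightarrow> k \<notin> J0 \<Longrightarrow> infdist p (K k) < 2 * r k \<Longrightarrow> 3/2 * r k < infdist p (K k)"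
        "\<And>p. p \<in> ball p0 d \<Longrightarrow> p0 \<notin> N \<Longrightarrow> p \<notin> S"
        "\<And>p. p \<in> ball p0 d \<Longrightarrow> p0 \<in> N \<Longrightarrow> \<exists>n\<in>J0. infdist p (K n) < r n / 2"
      proof -
        obtain d where "d > 0" "\<forall>p. dist p p0 < d \<longrightarrow>
          ((\<forall>k\<in>J0. infdist p (K k) < 2 * r k \<and> p - s k *\<^sub>R e \<in> U - closure S) \<and>
          (\<forall>k. K k \<noteq> {} \<and> k \<notin> J0 \<and> infdist p (K k) < 2 * r k \<longrightarrow> 3/2 * r k < infdist p (K k))) \<and>
          (p0 \<notin> N \<longrightarrow> p \<notin> S) \<and> (p0 \<in> N \<longrightarrow> (\<exists>n\<in>J0. infdist p (K n) < r n / 2))"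
          using eventually_conj[OF common switch] unfolding eventually_nhds_metric by blast
        thus thesis by (intro that[of d]) (simp_all add: dist_commute)
      qed
      have J0K: "K k \<noteq> {}" if "k \<in> J0" for k using that by (simp add: J0_def)
      have notS: "p - s k *\<^sub>R e \<notin> S" if "p \<in> ball p0 d" "k \<in> J0" for p k
        using d(2)[OF that] closure_subset by blast
      have "segment_concave_on (?T \<inter> ball p0 d) h"
        unfolding h_def
      proof (rule segment_concave_on_Min_dominated[OF finJ neJ])
        fix j assume j: "j \<in> J"
        show "segment_concave_on (?T \<inter> ball p0 d) (c j)"
        proof (cases j)
          case None
          hence "p0 \<notin> N" using j by (auto simp: J_def split: if_splits)
          hence "?T \<inter> ball p0 d \<subseteq> closure U - S" using d(4) NU closure_subset by blast
          thus ?thesis using segment_concave_on_subset[OF A] None by (simp add: c_def)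
        next
          case (Some k)
          hence "k \<in> J0" using j by (auto simp: J_def split: if_splits)
          hence "segment_concave_on (ball p0 d) (G k)" using d(2) J0K by (intro G_concave) auto
          hence "segment_concave_on (?T \<inter> ball p0 d) (G k)" by (rule segment_concave_on_subset) blast
          thus ?thesis using Some by (simp add: c_def)
        qed
      next
        fix p assume p: "p \<in> ?T \<inter> ball p0 d"
        hence pb: "p \<in> ball p0 d" by blast
        show "finite (D p)" by (rule finD)
        show "J \<subseteq> D p"
          unfolding J_def D_def using d(2,4)[OF pb] notS[OF pb] J0K by auto
        fix i assume i: "i \<in> D p"
        show "\<exists>j\<in>J. c j p \<le> c i p"
        proof (cases "i \<in> J")
          case False
          show ?thesis
          proof (cases i)
            case None
            hence pS: "p \<notin> S" and "p0 \<in> N" using i False by (auto simp: D_def J_def split: if_splits)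
            then obtain n where n: "n \<in> J0" "infdist p (K n) < r n / 2" using d(5)[OF pb] by blast
            hence "c (Some n) p \<le> c i p" using G_le_A[OF J0K n(2) pS] None by (simp add: c_def)
            thus ?thesis using n(1) by (auto simp: J_def)
          next
            case (Some k)
            hence k: "K k \<noteq> {}" "infdist p (K k) < 2 * r k" "p - s k *\<^sub>R e \<notin> S" "k \<notin> J0"
              using i False by (auto simp: D_def J_def)
            have far_k: "3/2 * r k < infdist p (K k)" by (rule d(3)[OF pb k(1,4,2)])
            show ?thesis
            proof (cases "p0 \<in> N")
              case True
              then obtain n where n: "n \<in> J0" "infdist p (K n) < r n / 2" using d(5)[OF pb] by blast
              have "G n p \<le> G k p"
                by (rule G_le_G[OF k(1) less_imp_le[OF k(2)] far_k k(3) J0K[OF n(1)] n(2) notS[OF pb n(1)]])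
              hence "c (Some n) p \<le> c i p" using Some by (simp add: c_def)
              thus ?thesis using n(1) by (auto simp: J_def)
            next
              case False
              have "A p \<le> G k p"
                by (rule A_le_G[OF k(1) less_imp_le[OF k(2)] far_k d(4)[OF pb False]])
              hence "c None p \<le> c i p" using Some by (simp add: c_def)
              thus ?thesis using False by (auto simp: J_def)
            qed
          qed
        qed auto
      qed
      thus "\<exists>d>0. segment_concave_on (?T \<inter> ball p0 d) h" using d(1) by blast
    qed
  qed
qed

section \<open>Bellman functions and extensions\<close>

lemma closure_diff_eq:
  fixes U S :: "'a::topological_space set"
  assumes "open U" "open S" "closure S \<subseteq> U"
  shows "closure (U - S) = closure U - S"
proof
  show "closure (U - S) \<subseteq> closure U - S"
  proof -
    have "closure (U - S) \<subseteq> - S" using assms(2) by (intro closure_minimal) auto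
    moreover have "closure (U - S) \<subseteq> closure U" by (intro closure_mono) blast
    ultimately show ?thesis by blast
  qed
  show "closure U - S \<subseteq> closure (U - S)"
  proof
    fix p assume p: "p \<in> closure U - S"
    show "p \<in> closure (U - S)"
    proof (cases "p \<in> U")
      case True
      hence "p \<in> U - S" using p by blast
      thus ?thesis using closure_subset[of "U - S"] by blast
    next
      case False
      hence "p \<in> (- closure S) \<inter> closure U" using p assms(3) by blast
      hence "p \<in> closure ((- closure S) \<inter> U)"
        using open_Int_closure_subset[OF open_Compl[OF closed_closure], of S U] by blast
      moreover have "(- closure S) \<inter> U \<subseteq> U - S" using closure_subset[of S] by blast
      ultimately show ?thesis using closure_mono[of "- closure S \<inter> U" "U - S"] by blast
    qed
  qed
qed

lemma locally_concave_on_subset: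
  "locally_concave_on T G \<Longrightarrow> S \<subseteq> T \<Longrightarrow> locally_concave_on S G"
  unfolding locally_concave_on_def by blast

text \<open>Enlarging the domain adds segments to be tested, so fewer functions are
  admissible.\<close>

lemma bellman_antimono:
  assumes "S \<subseteq> T"
  shows "bellman U S f x \<le> bellman U T f x"
  unfolding bellman_def Lambda_class_def
  by (rule INF_superset_mono) (auto intro: locally_concave_on_subset[OF _ assms])

lemma segment_concave_on_imp_locally_concave_on:
  assumes "segment_concave_on S h"
  shows "locally_concave_on S (\<lambda>p. ereal (h p))"
  unfolding locally_concave_on_def ereal_concave_on_def
proof (intro conjI ballI allI impI)
  fix a b x y and t :: real
  assume ab: "closed_segment a b \<subseteq> S" and *: "x \<in> closed_segment a b" "y \<in> closed_segment a b" "t \<in> {0..1}"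
  have "closed_segment x y \<subseteq> S" using ab * subset_closed_segment by blast
  from segment_concave_onD[OF assms this, of t]
  show "ereal (1 - t) * ereal (h x) + ereal t * ereal (h y) \<le> ereal (h ((1 - t) *\<^sub>R x + t *\<^sub>R y))"
    using * by simp
qed auto

lemma locally_concave_on_imp_segment_concave_on:
  assumes G: "locally_concave_on S G" and fin: "\<And>p. p \<in> S \<Longrightarrow> G p \<noteq> \<infinity>"
  shows "segment_concave_on S (\<lambda>p. real_of_ereal (G p))"
  unfolding segment_concave_on_def
proof (intro allI impI concave_onI)
  fix a b x y and t :: real
  assume ab: "closed_segment a b \<subseteq> S"
    and *: "x \<in> closed_segment a b" "y \<in> closed_segment a b" "0 \<le> t" "t \<le> 1"
  let ?z = "(1 - t) *\<^sub>R x + t *\<^sub>R y"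
  have real: "ereal (real_of_ereal (G p)) = G p" if "p \<in> S" for p
    using G fin[OF that] that unfolding locally_concave_on_def by (auto simp: ereal_real)
  have "ereal_concave_on (closed_segment a b) G" using G ab unfolding locally_concave_on_def by blast
  hence "ereal (1 - t) * G x + ereal t * G y \<le> G ?z" and z: "?z \<in> closed_segment a b"
    using * convexD_alt[of "closed_segment a b"] unfolding ereal_concave_on_def by auto
  moreover have "x \<in> S" "y \<in> S" "?z \<in> S" using ab * z by blast+
  ultimately have "ereal (1 - t) * ereal (real_of_ereal (G x)) + ereal t * ereal (real_of_ereal (G y))
      \<le> ereal (real_of_ereal (G ?z))"
    by (simp only: real)
  thus "(1 - t) * real_of_ereal (G x) + t * real_of_ereal (G y) \<le> real_of_ereal (G ?z)" by simp
qed simp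

text \<open>The function with value \<open>f x\<close> at \<open>x\<close> and infinity elsewhere is
  admissible: strict convexity of \<open>U\<close> keeps \<open>x\<close> out of every open segment
  in \<open>W\<close>, and at an endpoint the convention that 0 times infinity is 0 leaves only the
  value there.\<close>

lemma bellman_le_on_frontier:
  fixes U W :: "'a::euclidean_space set"
  assumes U: "open U" "convex U" "\<not> contains_segment (frontier U)"
    and W: "W \<subseteq> closure U" and x: "x \<in> frontier U"
  shows "bellman U W f x \<le> ereal (f x)"
proof -
  define G where "G p = (if p = x then ereal (f x) else \<infinity>)" for p
  have xU: "x \<notin> U" using x U(1) by (simp add: frontier_def interior_open)
  have "locally_concave_on W G"
    unfolding locally_concave_on_def ereal_concave_on_def
  proof (intro conjI ballI allI impI)
    fix a b u v and t :: real
    assume ab: "closed_segment a b \<subseteq> W"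
      and *: "u \<in> closed_segment a b" "v \<in> closed_segment a b" "t \<in> {0..1}"
    show "ereal (1 - t) * G u + ereal t * G v \<le> G ((1 - t) *\<^sub>R u + t *\<^sub>R v)"
    proof (cases "(1 - t) *\<^sub>R u + t *\<^sub>R v = x \<and> t \<noteq> 0 \<and> t \<noteq> 1 \<and> u \<noteq> v")
      case True
      have "0 < t" "t < 1" "x = (1 - t) *\<^sub>R u + t *\<^sub>R v" "u \<noteq> v" using True *(3) by auto
      hence "x \<in> open_segment u v" unfolding in_segment by blast
      moreover have "u \<in> closure U" "v \<in> closure U" using ab * W by blast+
      ultimately have False using open_segment_subset_strictly_convex[OF U] xU by blast
      thus ?thesis ..
    next
      case False
      show ?thesis
      proof (rule ccontr)
        assume no: "\<not> ereal (1 - t) * G u + ereal t * G v \<le> G ((1 - t) *\<^sub>R u + t *\<^sub>R v)"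
        hence z: "(1 - t) *\<^sub>R u + t *\<^sub>R v = x" by (auto simp: G_def split: if_splits)
        have "t \<noteq> 0" "t \<noteq> 1"
          using no by (auto simp flip: zero_ereal_def one_ereal_def)
        hence uv: "u = v" using False z by blast
        hence "u = x" using z by (simp flip: scaleR_add_left)
        hence "ereal (1 - t) * G u + ereal t * G v = ereal (f x)"
          using uv by (simp add: G_def algebra_simps)
        thus False using no z by (simp add: G_def)
      qed
    qed
  qed (auto simp: G_def)
  hence "G \<in> Lambda_class U W f" by (simp add: Lambda_class_def G_def)
  hence "bellman U W f x \<le> G x" unfolding bellman_def by (rule INF_lower)
  thus ?thesis by (simp add: G_def)
qed

text \<open>Translations compose, so a core containing one translate of the hole inherits the
  property for all rays.\<close>

lemma rays_translatable_core:
  assumes "rays_translatable U S" "(+) w ` S \<subseteq> V"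
  shows "rays_translatable U V"
  unfolding rays_translatable_def
proof (intro allI impI)
  fix R assume "is_ray R \<and> R \<subseteq> U"
  then obtain v where v: "(+) v ` R \<subseteq> S" using assms(1) unfolding rays_translatable_def by blast
  have "(+) (w + v) ` R \<subseteq> (+) w ` ((+) v ` R)" by (auto simp: add.assoc image_image)
  also have "\<dots> \<subseteq> V" using v assms(2) by blast
  finally show "\<exists>w. (+) w ` R \<subseteq> V" by blast
qed

text \<open>\<open>l\<close> is a normalized sum of spanning functionals bounded below on
  \<open>U\<close>. An upper bound on the sum bounds each summand, because the others are bounded
  below, and hence bounds the point; since the ray is unbounded, the sum must increase along
  \<open>e\<close>.\<close>

lemma unbounded_hole_geometry:
  fixes U S :: "'a::euclidean_space set"
  assumes U: "open U" "convex U" "U \<noteq> {}" "\<not> contains_line U" "\<not> bounded U"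
    and rays: "rays_translatable U S" and SU: "S \<subseteq> U"
  obtains e p0 l \<beta> where "norm e = 1" "\<And>t. 0 \<le> t \<Longrightarrow> p0 + t *\<^sub>R e \<in> S" "l \<bullet> e = 1"
    "\<And>x. x \<in> S \<Longrightarrow> \<beta> \<le> l \<bullet> x" "\<And>k. bounded (S \<inter> {x. l \<bullet> x \<le> k})"
proof -
  obtain q v where v: "v \<noteq> 0" "\<And>t. 0 \<le> t \<Longrightarrow> q + t *\<^sub>R v \<in> U"
    using unbounded_convex_contains_ray[OF U(1,2,5)] by blast
  let ?R = "(\<lambda>t::real. q + t *\<^sub>R v) ` {0..}"
  have "is_ray ?R" unfolding is_ray_def using v(1) by blast
  moreover have "?R \<subseteq> U" using v(2) by auto
  ultimately obtain w where w: "(+) w ` ?R \<subseteq> S" using rays unfolding rays_translatable_def by blast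
  have Sv: "(w + q) + t *\<^sub>R v \<in> S" if "0 \<le> t" for t
  proof -
    have "w + (q + t *\<^sub>R v) \<in> (+) w ` ?R" using that by blast
    thus ?thesis using w by (auto simp: add.assoc)
  qed
  define e where "e = v /\<^sub>R norm v"
  have e: "norm e = 1" using v(1) by (simp add: e_def)
  have Se: "(w + q) + t *\<^sub>R e \<in> S" if "0 \<le> t" for t
    using Sv[of "t / norm v"] that by (simp add: e_def divide_inverse)
  obtain A b where A: "finite A" "span A = UNIV" "\<And>a x. a \<in> A \<Longrightarrow> x \<in> U \<Longrightarrow> b a \<le> a \<bullet> x"
    using finite_spanning_barrier[OF U(1-4)] by blast
  obtain c where c: "c > 0" "\<And>x. c * (norm x)\<^sup>2 \<le> (\<Sum>a\<in>A. (a \<bullet> x)\<^sup>2)"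
    using sum_squares_spanning_bound[OF A(1,2)] by blast
  define L where "L = \<Sum>A"
  define B where "B = (\<Sum>a\<in>A. \<bar>b a\<bar>)"
  have Lx: "L \<bullet> x = (\<Sum>a\<in>A. a \<bullet> x)" for x unfolding L_def by (rule inner_sum_left)
  have bB: "\<bar>b a\<bar> \<le> B" if "a \<in> A" for a unfolding B_def using that A(1) by (intro member_le_sum) auto
  have lowA: "- \<bar>b a\<bar> \<le> a \<bullet> x" if "a \<in> A" "x \<in> S" for a x
    using A(3)[of a x] SU that by force
  have low: "- B \<le> L \<bullet> x" if "x \<in> S" for x
    unfolding Lx B_def sum_negf[symmetric] using lowA that by (intro sum_mono) auto
  have up: "\<bar>a \<bullet> x\<bar> \<le> \<bar>k\<bar> + B" if a: "a \<in> A" and x: "x \<in> S" "L \<bullet> x \<le> k" for a x k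
  proof -
    have "a \<bullet> x = L \<bullet> x - (\<Sum>a\<in>A - {a}. a \<bullet> x)" unfolding Lx using a A(1) by (simp add: sum.remove)
    moreover have "- (\<Sum>a\<in>A - {a}. \<bar>b a\<bar>) \<le> (\<Sum>a\<in>A - {a}. a \<bullet> x)"
      unfolding sum_negf[symmetric] using lowA x by (intro sum_mono) auto
    moreover have "(\<Sum>a\<in>A - {a}. \<bar>b a\<bar>) \<le> B" unfolding B_def using A(1) by (intro sum_mono2) auto
    ultimately show ?thesis using x(2) lowA[OF a x(1)] bB[OF a] by linarith
  qed
  have bdd: "bounded (S \<inter> {x. L \<bullet> x \<le> k})" for k
  proof -
    have "norm x \<le> sqrt (real (card A) * (\<bar>k\<bar> + B)\<^sup>2 / c)" if x: "x \<in> S \<inter> {x. L \<bullet> x \<le> k}" for x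
    proof (rule real_le_rsqrt)
      have "(\<Sum>a\<in>A. (a \<bullet> x)\<^sup>2) \<le> (\<Sum>a\<in>A. (\<bar>k\<bar> + B)\<^sup>2)"
      proof (rule sum_mono)
        fix a assume a: "a \<in> A"
        have "\<bar>a \<bullet> x\<bar>\<^sup>2 \<le> (\<bar>k\<bar> + B)\<^sup>2" using up[OF a, of x k] x by (intro power_mono) auto
        thus "(a \<bullet> x)\<^sup>2 \<le> (\<bar>k\<bar> + B)\<^sup>2" by simp
      qed
      hence "c * (norm x)\<^sup>2 \<le> real (card A) * (\<bar>k\<bar> + B)\<^sup>2" using c(2)[of x] by simp
      thus "(norm x)\<^sup>2 \<le> real (card A) * (\<bar>k\<bar> + B)\<^sup>2 / c" using c(1) by (simp add: field_simps)
    qed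
    thus ?thesis unfolding bounded_iff by blast
  qed
  have Le: "L \<bullet> e > 0"
  proof (rule ccontr)
    assume no: "\<not> L \<bullet> e > 0"
    obtain M where M: "\<And>x. x \<in> S \<inter> {x. L \<bullet> x \<le> L \<bullet> (w + q)} \<Longrightarrow> norm x \<le> M"
      using bdd unfolding bounded_iff by blast
    define t where "t = \<bar>M\<bar> + norm (w + q) + 1"
    have t0: "0 \<le> t" by (simp add: t_def)
    have "L \<bullet> ((w + q) + t *\<^sub>R e) = L \<bullet> (w + q) + t * (L \<bullet> e)" by (simp add: inner_add_right)
    hence "L \<bullet> ((w + q) + t *\<^sub>R e) \<le> L \<bullet> (w + q)"
      using no t0 by (simp add: mult_nonneg_nonpos)
    hence "norm ((w + q) + t *\<^sub>R e) \<le> M" using Se[OF t0] by (intro M) simp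
    moreover have "t \<le> norm ((w + q) + t *\<^sub>R e) + norm (w + q)"
      using norm_triangle_ineq4[of "(w + q) + t *\<^sub>R e" "w + q"] e t0 by simp
    ultimately show False unfolding t_def by linarith
  qed
  show thesis
  proof
    show "norm e = 1" by (rule e)
    show "(w + q) + t *\<^sub>R e \<in> S" if "0 \<le> t" for t by (rule Se[OF that])
    show "(L /\<^sub>R (L \<bullet> e)) \<bullet> e = 1" using Le by simp
    show "- B / (L \<bullet> e) \<le> (L /\<^sub>R (L \<bullet> e)) \<bullet> x" if "x \<in> S" for x
      using divide_right_mono[OF low[OF that], of "L \<bullet> e"] Le by (simp add: divide_inverse mult.commute)
    show "bounded (S \<inter> {x. (L /\<^sub>R (L \<bullet> e)) \<bullet> x \<le> k})" for k
    proof (rule bounded_subset[OF bdd])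
      show "S \<inter> {x. (L /\<^sub>R (L \<bullet> e)) \<bullet> x \<le> k} \<subseteq> S \<inter> {x. L \<bullet> x \<le> k * (L \<bullet> e)}"
        using Le by (auto simp: field_simps)
    qed
  qed
qed

theorem bellman_eq_Inf_extensions:
  fixes U S :: "'a::euclidean_space set" and f :: "'a \<Rightarrow> real"
  assumes dim: "2 \<le> DIM('a)"
    and U: "open U" "convex U" "U \<noteq> {}" "\<not> contains_line U" "\<not> bounded U"
    and Ufr: "\<not> contains_segment (frontier U)"
    and S: "open S" "convex S" "\<not> contains_segment (frontier S)" "closure S \<subseteq> U"
    and rays: "rays_translatable U S"
    and x: "x \<in> closure (U - S)"
  shows "bellman U (closure (U - S)) f x = Inf {bellman U W f x | W. is_extension U S W}"
proof -
  have cl: "closure (U - S) = closure U - S" by (rule closure_diff_eq[OF U(1) S(1,4)])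
  have SU: "S \<subseteq> U" using S(4) closure_subset by blast
  obtain e p0 l \<beta> where e: "norm e = 1" and ray: "\<And>t. 0 \<le> t \<Longrightarrow> p0 + t *\<^sub>R e \<in> S" and le: "l \<bullet> e = 1"
    and lb: "\<And>x. x \<in> S \<Longrightarrow> \<beta> \<le> l \<bullet> x" and bd: "\<And>k. bounded (S \<inter> {x. l \<bullet> x \<le> k})"
    using unbounded_hole_geometry[OF U rays SU] by blast
  have core: "\<exists>V. is_extension U S (closure U - V) \<and> S - V \<subseteq> N" if N: "open N" "frontier S \<subseteq> N" for N
  proof -
    obtain V where V: "open V" "convex V" "closure V \<subseteq> S" "\<not> contains_segment (frontier V)"
      "\<exists>w. (+) w ` S \<subseteq> V" "S - V \<subseteq> N"
      by (rule strictly_convex_core[OF S(1-3) ray le lb bd N])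
    obtain w where "(+) w ` S \<subseteq> V" using V(5) by blast
    hence "rays_translatable U V" by (rule rays_translatable_core[OF rays])
    hence "is_extension U S (closure U - V)" unfolding is_extension_def using V(1-4) by blast
    thus ?thesis using V(6) by blast
  qed
  let ?I = "Inf {bellman U W f x | W. is_extension U S W}"
  have "bellman U (closure U - S) f x \<le> ?I"
  proof (rule Inf_greatest)
    fix y assume "y \<in> {bellman U W f x | W. is_extension U S W}"
    then obtain W where W: "y = bellman U W f x" "is_extension U S W" by blast
    have "closure U - S \<subseteq> W" using W(2) closure_subset unfolding is_extension_def by blast
    thus "bellman U (closure U - S) f x \<le> y" unfolding W(1) by (rule bellman_antimono)
  qed
  moreover have "?I \<le> bellman U (closure U - S) f x"
  proof (cases "x \<in> U")
    \<comment> \<open>A finite value at an outer frontier point does not propagate inward, so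
      nothing is extended in this case; a single extension squeezes both sides to
      \<open>f x\<close>.\<close>
    case False
    hence xf: "x \<in> frontier U" using x U(1) cl by (auto simp: frontier_def interior_open)
    obtain V where V: "is_extension U S (closure U - V)" using core[of UNIV] by auto
    have "?I \<le> bellman U (closure U - V) f x" using V by (intro Inf_lower) blast
    also have "\<dots> \<le> ereal (f x)" by (rule bellman_le_on_frontier[OF U(1,2) Ufr _ xf]) blast
    also have "\<dots> \<le> bellman U (closure U - S) f x"
      unfolding bellman_def Lambda_class_def using xf by (intro INF_greatest) blast
    finally show ?thesis .
  next
    case xU: True
    show ?thesis
      unfolding bellman_def[of U "closure U - S"]
    proof (rule INF_greatest)
      fix G assume G: "G \<in> Lambda_class U (closure U - S) f"
      show "?I \<le> G x"
      proof (cases "G x = \<infinity>")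
        case False
        have lc: "locally_concave_on (closure U - S) G" and Gf: "\<And>x. x \<in> frontier U \<Longrightarrow> ereal (f x) \<le> G x"
          using G by (auto simp: Lambda_class_def)
        have rayc: "p0 + t *\<^sub>R e \<in> closure S" if "0 \<le> t" for t using ray[OF that] closure_subset by blast
        have lbc: "\<beta> \<le> l \<bullet> x" if "x \<in> closure S" for x
        proof -
          have "closure S \<subseteq> {x. \<beta> \<le> l \<bullet> x}"
            by (rule closure_minimal) (use lb in \<open>auto simp: closed_halfspace_ge\<close>)
          thus ?thesis using that by auto
        qed
        have conn0: "connected (- closure S)"
          by (rule connected_complement_closed_convex[OF closed_closure convex_closure[OF S(2)] rayc _ lbc])
            (use le in auto)
        \<comment> \<open>The connectedness argument measures the distance to the complement of
          \<open>U\<close>, which therefore has to be nonempty.\<close>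
        have Uneq: "U \<noteq> UNIV"
        proof
          assume "U = UNIV"
          moreover have "e \<noteq> 0" using e by auto
          ultimately show False using U(4) unfolding contains_line_def by blast
        qed
        have ne: "closure S \<noteq> {}" using rayc[of 0] by auto
        have conn: "connected (U - closure S)"
          by (rule connected_diff_closed_convex[OF U(1,2) closed_closure convex_closure[OF S(2)] ne S(4) Uneq conn0])
        have xS: "x \<in> U - S" using x cl xU by blast
        have fin: "G y \<noteq> \<infinity>" if "y \<in> closure U - S" for y
          by (rule locally_concave_on_finite[OF dim U(1,2) S conn lc xS False that])
        define g where "g p = real_of_ereal (G p)" for p
        have g: "segment_concave_on (closure U - S) g"
          unfolding g_def by (rule locally_concave_on_imp_segment_concave_on[OF lc fin])
        have gG: "ereal (g p) = G p" if "p \<in> closure U - S" for p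
          using lc fin[OF that] that unfolding g_def locally_concave_on_def by (auto simp: ereal_real)
        show ?thesis
        proof (rule ereal_le_epsilon2)
          fix \<epsilon> :: real assume "0 < \<epsilon>"
          obtain N h where N: "open N" "frontier S \<subseteq> N"
            and h: "segment_concave_on ((closure U - S) \<union> N) h"
            "\<And>p. p \<in> frontier U \<Longrightarrow> g p \<le> h p" "\<And>p. p \<in> closure U - S \<Longrightarrow> h p \<le> g p + \<epsilon>"
            using extend_segment_concave[OF dim U(1-4) S ray e g \<open>0 < \<epsilon>\<close>] by blast
          obtain V where V: "is_extension U S (closure U - V)" "S - V \<subseteq> N" using core[OF N] by blast
          \<comment> \<open>What the core \<open>V\<close> gives up of the hole lies in
            \<open>N\<close>, so the extended domain is covered by the set on which \<open>h\<close>
            is concave along segments.\<close>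
          have "segment_concave_on (closure U - V) h"
            by (rule segment_concave_on_subset[OF h(1)]) (use V(2) in blast)
          hence "locally_concave_on (closure U - V) (\<lambda>p. ereal (h p))"
            by (rule segment_concave_on_imp_locally_concave_on)
          moreover have "ereal (f p) \<le> ereal (h p)" if p: "p \<in> frontier U" for p
          proof -
            have "p \<in> closure U - S" using p U(1) SU by (auto simp: frontier_def interior_open)
            hence "ereal (f p) \<le> ereal (g p)" using Gf[OF p] gG by simp
            thus ?thesis using h(2)[OF p] by simp
          qed
          ultimately have "(\<lambda>p. ereal (h p)) \<in> Lambda_class U (closure U - V) f"
            by (simp add: Lambda_class_def)
          hence "bellman U (closure U - V) f x \<le> ereal (h x)" unfolding bellman_def by (rule INF_lower)
          moreover have "?I \<le> bellman U (closure U - V) f x" using V(1) by (intro Inf_lower) blast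
          moreover have "ereal (h x) \<le> G x + ereal \<epsilon>" using h(3)[of x] gG[of x] x cl by (simp flip: gG)
          ultimately show "?I \<le> G x + ereal \<epsilon>" by (meson order_trans)
        qed
      qed simp
    qed
  qed
  ultimately show ?thesis unfolding cl by (rule antisym)
qed

theorem theorem4p1:
  fixes \<Omega>\<^sub>0 \<Omega>\<^sub>1 :: "(real^2) set" and f :: "real^2 \<Rightarrow> real"
  assumes "\<Omega>\<^sub>0 \<noteq> {}" and "open \<Omega>\<^sub>0" and "convex \<Omega>\<^sub>0" and "\<not> contains_line \<Omega>\<^sub>0"
    and "open \<Omega>\<^sub>1" and "convex \<Omega>\<^sub>1" and "closure \<Omega>\<^sub>1 \<subseteq> \<Omega>\<^sub>0"
    and "\<not> contains_segment (frontier \<Omega>\<^sub>0)"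
    and "\<not> contains_segment (frontier \<Omega>\<^sub>1)"
    and "C2_smooth_curve (frontier \<Omega>\<^sub>1)"
    and "\<not> bounded \<Omega>\<^sub>0"
    and "rays_translatable \<Omega>\<^sub>0 \<Omega>\<^sub>1"
    and "C2_smooth_curve (frontier \<Omega>\<^sub>0)"
    and "C2_on_curve (frontier \<Omega>\<^sub>0) f"
  shows "\<forall>x \<in> closure (\<Omega>\<^sub>0 - \<Omega>\<^sub>1).
    bellman \<Omega>\<^sub>0 (closure (\<Omega>\<^sub>0 - \<Omega>\<^sub>1)) f x =
    Inf {bellman \<Omega>\<^sub>0 W f x | W. is_extension \<Omega>\<^sub>0 \<Omega>\<^sub>1 W}"
  by (intro ballI bellman_eq_Inf_extensions assms) simp

end
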